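(* Let $\omega$ be an open strict interval of $\mathbb T$ and let $T>0$. For every $k\in \mathbb N$, the set $\mathcal{NC}_{H^2}(\omega,T)\cap W^{k,2}(\mathbb T)$ is dense in $H^2\cap W^{k,2}(\mathbb T)$, where $H^2\cap W^{k,2}(\mathbb T)$ is endowed with the $W^{k,2}(\mathbb T)$ scalar product.
   Context: $\mathbb T$ is the complex unit circle, identified with $\mathbb R/2\pi\mathbb Z$ via $x\mapsto e^{ix}$. An open strict interval of $\mathbb T$ is an open arc $\{e^{ix}:a<x<b\}$ with $0<b-a<2\pi$. Functions are complex valued; $f\in L^2(\mathbb T)$ is written $f(e^{ix})=\sum_{n\in\mathbb Z}\widehat f(n)e^{inx}$. $W^{k,2}(\mathbb T)$ is the Sobolev space with scalar product $\langle f,g\rangle_{W^{k,2}(\mathbb T)}=\sum_{n\in\mathbb Z}(1+n^2)^k\widehat f(n)\overline{\widehat g(n)}$. The Riesz projector is $P_+f(e^{ix})=\sum_{n\ge 0}\widehat f(n)e^{inx}$, and $H^2=P_+L^2(\mathbb T)$. Let $S(t)f(e^{ix})=\sum_{n}\widehat f(n)e^{-|n|t}e^{inx}$ (the semigroup generated by $-|D|$, $|D|f=\sum_n|n|\widehat f(n)e^{inx}$). The $H^2$ control system is $(\partial_t+|D|)f(t,e^{ix})=P_+\mathbf 1_\omega u(t,e^{ix})$, $f(0,\cdot)=f_0\in H^2$, with control $u\in L^2([0,T]\times\omega)$; its solution satisfies $f(T,\cdot)=S(T)f_0+\int_0^TS(T-s)P_+(\mathbf 1_\omega u(s,\cdot))\,ds$,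 where $\mathbf 1_\omega u$ denotes the extension of $u$ by $0$ outside $\omega$. $\mathcal{NC}_{H^2}(\omega,T)$ is the set of $f_0\in H^2$ for which there is $u\in L^2([0,T]\times\omega)$ with $f(T,\cdot)=0$. (This set does not depend on $T>0$.) *)

theory Defs
  imports "HOL-Analysis.Analysis"
begin

definition square_integrable :: "'a measure \<Rightarrow> ('a \<Rightarrow> complex) \<Rightarrow> bool" where
  "square_integrable M f \<longleftrightarrow> f \<in> borel_measurable M \<and> integrable M (\<lambda>x. (cmod (f x))\<^sup>2)"

text \<open>Normalised arc length \<open>dx / (2 * pi)\<close> on the unit circle, as a Borel measure on the plane:
  a function on the circle is a function on the plane, and its values off the circle are
  irrelevant.\<close>

definition circle :: "complex measure" where
  "circle = distr (uniform_measure lborel {0..<2 * pi}) borel cis"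

lemma sets_circle [simp, measurable_cong]: "sets circle = sets borel"
  and space_circle [simp]: "space circle = UNIV"
  by (simp_all add: circle_def)

lemma cis_measurable: "cis \<in> borel_measurable borel"
  by (intro borel_measurable_continuous_onI continuous_intros)

interpretation circle: finite_measure circle
proof
  show "emeasure circle (space circle) \<noteq> \<infinity>"
    using cis_measurable by (simp add: circle_def emeasure_distr emeasure_uniform_measure ennreal_divide_eq_top_iff)
qed

lemma square_integrable_circle_borel:
  "square_integrable circle f \<Longrightarrow> f \<in> borel_measurable borel"
  by (simp add: square_integrable_def measurable_cong_sets[OF sets_circle refl])

lemma square_integrable_zero: "square_integrable M (\<lambda>_. 0)"
  by (simp add: square_integrable_def)

lemma square_integrable_mult:
  assumes "square_integrable M f" "square_integrable M g"
  shows "integrable M (\<lambda>x. f x * g x)"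
proof (rule Bochner_Integration.integrable_bound)
  show "integrable M (\<lambda>x. (cmod (f x))\<^sup>2 + (cmod (g x))\<^sup>2)"
    using assms by (auto simp: square_integrable_def)
  show "(\<lambda>x. f x * g x) \<in> borel_measurable M"
    using assms by (auto simp: square_integrable_def)
  show "AE x in M. norm (f x * g x) \<le> norm ((cmod (f x))\<^sup>2 + (cmod (g x))\<^sup>2)"
  proof (rule AE_I2)
    fix x
    have "2 * (cmod (f x) * cmod (g x)) \<le> (cmod (f x))\<^sup>2 + (cmod (g x))\<^sup>2"
      using sum_squares_bound[of "cmod (f x)" "cmod (g x)"] by simp
    moreover have "0 \<le> cmod (f x) * cmod (g x)" by simp
    ultimately have "cmod (f x) * cmod (g x) \<le> (cmod (f x))\<^sup>2 + (cmod (g x))\<^sup>2" by linarith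
    then show "norm (f x * g x) \<le> norm ((cmod (f x))\<^sup>2 + (cmod (g x))\<^sup>2)"
      by (simp add: norm_mult)
  qed
qed

lemma square_integrable_bound:
  assumes "square_integrable M f" "g \<in> borel_measurable M" "\<And>x. cmod (g x) \<le> c * cmod (f x)"
  shows "square_integrable M g"
  unfolding square_integrable_def
proof
  show "integrable M (\<lambda>x. (cmod (g x))\<^sup>2)"
  proof (rule Bochner_Integration.integrable_bound)
    show "integrable M (\<lambda>x. c\<^sup>2 * (cmod (f x))\<^sup>2)"
      using assms(1) by (auto simp: square_integrable_def)
    show "AE x in M. norm ((cmod (g x))\<^sup>2) \<le> norm (c\<^sup>2 * (cmod (f x))\<^sup>2)"
      using power_mono[OF assms(3), of _ 2] by (auto simp: power_mult_distrib)
  qed (use assms(2) in measurable)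
qed (fact assms(2))

lemma square_integrable_cmult:
  "square_integrable M f \<Longrightarrow> square_integrable M (\<lambda>x. c * f x)"
  by (rule square_integrable_bound[where c = "cmod c"])
    (auto simp: norm_mult, auto simp: square_integrable_def)

lemma square_integrable_cnj:
  "square_integrable M f \<Longrightarrow> square_integrable M (\<lambda>x. cnj (f x))"
  using borel_measurable_continuous_onI[OF continuous_on_cnj[OF continuous_on_id], THEN measurable_compose_rev]
  by (auto simp: square_integrable_def intro: measurable_compose)

lemma square_integrable_add:
  assumes "square_integrable M f" "square_integrable M g"
  shows "square_integrable M (\<lambda>x. f x + g x)"
  unfolding square_integrable_def
proof
  show m: "(\<lambda>x. f x + g x) \<in> borel_measurable M"
    using assms by (auto simp: square_integrable_def)
  show "integrable M (\<lambda>x. (cmod (f x + g x))\<^sup>2)"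
  proof (rule Bochner_Integration.integrable_bound)
    show "integrable M (\<lambda>x. 2 * (cmod (f x))\<^sup>2 + 2 * (cmod (g x))\<^sup>2)"
      using assms by (auto simp: square_integrable_def)
    show "AE x in M. norm ((cmod (f x + g x))\<^sup>2) \<le> norm (2 * (cmod (f x))\<^sup>2 + 2 * (cmod (g x))\<^sup>2)"
    proof (rule AE_I2)
      fix x
      have "(cmod (f x + g x))\<^sup>2 \<le> (cmod (f x) + cmod (g x))\<^sup>2"
        by (intro power_mono norm_triangle_ineq) auto
      also have "\<dots> \<le> 2 * (cmod (f x))\<^sup>2 + 2 * (cmod (g x))\<^sup>2"
        using sum_squares_bound[of "cmod (f x)" "cmod (g x)"] by (simp add: power2_sum)
      finally show "norm ((cmod (f x + g x))\<^sup>2) \<le> norm (2 * (cmod (f x))\<^sup>2 + 2 * (cmod (g x))\<^sup>2)"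
        by simp
    qed
  qed (use m in measurable)
qed

lemma square_integrable_uminus:
  "square_integrable M f \<Longrightarrow> square_integrable M (\<lambda>x. - f x)"
  using square_integrable_cmult[of M f "-1"] by simp

lemma square_integrable_diff:
  "square_integrable M f \<Longrightarrow> square_integrable M g \<Longrightarrow> square_integrable M (\<lambda>x. f x - g x)"
  using square_integrable_add[OF _ square_integrable_uminus, of M f g] by simp

lemma square_integrable_scaleR:
  "square_integrable M f \<Longrightarrow> square_integrable M (\<lambda>x. r *\<^sub>R f x)"
  using square_integrable_cmult[of M f "of_real r"] by (simp add: scaleR_conv_of_real)

text \<open>The space \<open>L\<^sup>2\<close> of the circle, with almost everywhere equal functions identified. It is
  made a real Hilbert space, with the real part of the usual scalar product, and shown to be
  complete and separable, so that the Bochner integral and infinite sums of the library apply.\<close>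

definition circle_eq :: "(complex \<Rightarrow> complex) \<Rightarrow> (complex \<Rightarrow> complex) \<Rightarrow> bool" where
  "circle_eq f g \<longleftrightarrow> square_integrable circle f \<and> square_integrable circle g \<and>
     (AE z in circle. f z = g z)"

quotient_type circle_L2 = "complex \<Rightarrow> complex" / partial: circle_eq
proof (rule part_equivpI)
  show "\<exists>f. circle_eq f f"
    using square_integrable_zero by (auto simp: circle_eq_def)
  show "symp circle_eq"
    by (rule sympI) (auto simp: circle_eq_def)
  show "transp circle_eq"
    by (rule transpI) (auto simp: circle_eq_def)
qed

instantiation circle_L2 :: real_inner
begin

lift_definition zero_circle_L2 :: circle_L2 is "\<lambda>_. 0"
  by (simp add: circle_eq_def square_integrable_zero)

lift_definition plus_circle_L2 :: "circle_L2 \<Rightarrow> circle_L2 \<Rightarrow> circle_L2" is "\<lambda>f g z. f z + g z"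
  by (auto simp: circle_eq_def square_integrable_add)

lift_definition minus_circle_L2 :: "circle_L2 \<Rightarrow> circle_L2 \<Rightarrow> circle_L2" is "\<lambda>f g z. f z - g z"
  by (auto simp: circle_eq_def square_integrable_diff)

lift_definition uminus_circle_L2 :: "circle_L2 \<Rightarrow> circle_L2" is "\<lambda>f z. - f z"
  by (auto simp: circle_eq_def square_integrable_uminus)

lift_definition scaleR_circle_L2 :: "real \<Rightarrow> circle_L2 \<Rightarrow> circle_L2" is "\<lambda>r f z. r *\<^sub>R f z"
  by (auto simp: circle_eq_def square_integrable_scaleR)

lift_definition inner_circle_L2 :: "circle_L2 \<Rightarrow> circle_L2 \<Rightarrow> real"
  is "\<lambda>f g. \<integral>z. Re (f z * cnj (g z)) \<partial>circle"
  by (rule integral_cong_AE) (auto simp: circle_eq_def square_integrable_def)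

definition norm_circle_L2 :: "circle_L2 \<Rightarrow> real" where
  "norm_circle_L2 f = sqrt (inner f f)"

definition sgn_circle_L2 :: "circle_L2 \<Rightarrow> circle_L2" where
  "sgn_circle_L2 f = scaleR (inverse (norm f)) f"

definition dist_circle_L2 :: "circle_L2 \<Rightarrow> circle_L2 \<Rightarrow> real" where
  "dist_circle_L2 f g = norm (f - g)"

definition uniformity_circle_L2 :: "(circle_L2 \<times> circle_L2) filter" where
  "uniformity_circle_L2 = (INF e\<in>{0 <..}. principal {(x, y). dist x y < e})"

definition open_circle_L2 :: "circle_L2 set \<Rightarrow> bool" where
  "open_circle_L2 U \<longleftrightarrow> (\<forall>x\<in>U. eventually (\<lambda>(x', y). x' = x \<longrightarrow> y \<in> U) uniformity)"

instance
proof
  fix f g h :: circle_L2 and a b :: real and U :: "circle_L2 set"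
  show "f + g + h = f + (g + h)"
    by transfer (auto simp: circle_eq_def add.assoc square_integrable_add)
  show "f + g = g + f"
    by transfer (auto simp: circle_eq_def add.commute square_integrable_add)
  show "0 + f = f"
    by transfer (auto simp: circle_eq_def)
  show "- f + f = 0"
    by transfer (auto simp: circle_eq_def square_integrable_zero)
  show "f - g = f + - g"
    by transfer (auto simp: circle_eq_def square_integrable_diff)
  show "a *\<^sub>R (f + g) = a *\<^sub>R f + a *\<^sub>R g"
    by transfer (auto simp: circle_eq_def scaleR_add_right square_integrable_add square_integrable_scaleR)
  show "(a + b) *\<^sub>R f = a *\<^sub>R f + b *\<^sub>R f"
    by transfer (auto simp: circle_eq_def scaleR_add_left square_integrable_add square_integrable_scaleR)
  show "a *\<^sub>R b *\<^sub>R f = (a * b) *\<^sub>R f"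
    by transfer (auto simp: circle_eq_def square_integrable_scaleR)
  show "1 *\<^sub>R f = f"
    by transfer (auto simp: circle_eq_def)
  show "sgn f = scaleR (inverse (norm f)) f"
    by (fact sgn_circle_L2_def)
  show "dist f g = norm (f - g)"
    by (fact dist_circle_L2_def)
  show "uniformity = (INF e\<in>{0 <..}. principal {(x, y :: circle_L2). dist x y < e})"
    by (fact uniformity_circle_L2_def)
  show "open U \<longleftrightarrow> (\<forall>x\<in>U. eventually (\<lambda>(x', y). x' = x \<longrightarrow> y \<in> U) uniformity)"
    by (fact open_circle_L2_def)
  show "inner f g = inner g f"
    by transfer (simp add: mult.commute)
  have int: "integrable circle (\<lambda>z. Re (p z * cnj (q z)))"
    if "circle_eq p p" "circle_eq q q" for p q
    using that by (intro integrable_Re square_integrable_mult square_integrable_cnj) (auto simp: circle_eq_def)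
  show "inner (f + g) h = inner f h + inner g h"
    by transfer (simp add: ring_distribs int del: times_complex.sel complex_cnj
        flip: Bochner_Integration.integral_add)
  show "inner (a *\<^sub>R f) g = a * inner f g"
    by transfer (simp add: algebra_simps flip: integral_mult_right_zero)
  show "0 \<le> inner f f"
    by transfer (simp add: integral_nonneg_AE)
  show "inner f f = 0 \<longleftrightarrow> f = 0"
  proof transfer
    fix p assume p: "circle_eq p p"
    have eq: "Re (p z * cnj (p z)) = (cmod (p z))\<^sup>2" for z
      by (simp add: complex_mult_cnj cmod_power2)
    have "(\<integral>z. (cmod (p z))\<^sup>2 \<partial>circle) = 0 \<longleftrightarrow> (AE z in circle. (cmod (p z))\<^sup>2 = 0)"
      using p by (intro integral_nonneg_eq_0_iff_AE) (auto simp: circle_eq_def square_integrable_def)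
    then show "(\<integral>z. Re (p z * cnj (p z)) \<partial>circle) = 0 \<longleftrightarrow> circle_eq p (\<lambda>_. 0)"
      using p by (simp only: eq) (auto simp: circle_eq_def square_integrable_zero)
  qed
  show "norm f = sqrt (inner f f)"
    by (fact norm_circle_L2_def)
qed

end

text \<open>The class of a function; 0 if the function is not square integrable.\<close>

lift_definition L2_class :: "(complex \<Rightarrow> complex) \<Rightarrow> circle_L2"
  is "\<lambda>f. if square_integrable circle f then f else (\<lambda>_. 0)"
  by (simp add: circle_eq_def square_integrable_zero)

lemma L2_class_cases:
  obtains f where "square_integrable circle f" "F = L2_class f"
proof -
  have "\<exists>f. square_integrable circle f \<and> F = L2_class f"
    by transfer (auto simp: circle_eq_def)
  then show thesis using that by blast
qed

lemma L2_class_eq_iff: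
  "square_integrable circle f \<Longrightarrow> square_integrable circle g \<Longrightarrow>
    L2_class f = L2_class g \<longleftrightarrow> (AE z in circle. f z = g z)"
  by transfer (simp add: circle_eq_def)

lemma L2_class_zero: "L2_class (\<lambda>_. 0) = 0"
  by transfer (simp add: circle_eq_def square_integrable_zero)

lemma L2_class_add: "square_integrable circle f \<Longrightarrow> square_integrable circle g \<Longrightarrow>
    L2_class (\<lambda>z. f z + g z) = L2_class f + L2_class g"
  by transfer (simp add: circle_eq_def square_integrable_add)

lemma L2_class_diff: "square_integrable circle f \<Longrightarrow> square_integrable circle g \<Longrightarrow>
    L2_class (\<lambda>z. f z - g z) = L2_class f - L2_class g"
  by transfer (simp add: circle_eq_def square_integrable_diff)

lemma L2_class_scaleR: "square_integrable circle f \<Longrightarrow>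
    L2_class (\<lambda>z. r *\<^sub>R f z) = r *\<^sub>R L2_class f"
  by transfer (simp add: circle_eq_def square_integrable_scaleR)

lemma norm_L2_class:
  assumes "square_integrable circle f"
  shows "norm (L2_class f) = sqrt (\<integral>z. (cmod (f z))\<^sup>2 \<partial>circle)"
proof -
  have "inner (L2_class f) (L2_class f) = (\<integral>z. Re (f z * cnj (f z)) \<partial>circle)"
    using assms by transfer simp
  moreover have "Re (f z * cnj (f z)) = (cmod (f z))\<^sup>2" for z
    by (simp add: complex_mult_cnj cmod_power2)
  ultimately show ?thesis
    by (simp only: norm_eq_sqrt_inner[of "L2_class f"])
qed

lemma square_integrable_Fatou:
  assumes g: "\<And>n. square_integrable M (g n)" and h: "h \<in> borel_measurable M"
    and lim: "AE x in M. (\<lambda>n. g n x) \<longlonglongrightarrow> h x"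
    and le: "\<forall>\<^sub>F n in sequentially. (\<integral>x. (cmod (g n x))\<^sup>2 \<partial>M) \<le> c"
  shows "square_integrable M h" "(\<integral>x. (cmod (h x))\<^sup>2 \<partial>M) \<le> c"
proof -
  have [measurable]: "g n \<in> borel_measurable M" "h \<in> borel_measurable M" for n
    using g h by (auto simp: square_integrable_def)
  have c: "0 \<le> c"
    using eventually_happens'[OF sequentially_bot le]
    by (auto intro: order_trans[rotated] integral_nonneg_AE)
  have "(\<integral>\<^sup>+x. ennreal ((cmod (h x))\<^sup>2) \<partial>M)
      = (\<integral>\<^sup>+x. liminf (\<lambda>n. ennreal ((cmod (g n x))\<^sup>2)) \<partial>M)"
  proof (rule nn_integral_cong_AE, use lim in eventually_elim)
    fix x assume "(\<lambda>n. g n x) \<longlonglongrightarrow> h x"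
    then have "(\<lambda>n. ennreal ((cmod (g n x))\<^sup>2)) \<longlonglongrightarrow> ennreal ((cmod (h x))\<^sup>2)"
      by (intro tendsto_ennrealI tendsto_intros)
    then show "ennreal ((cmod (h x))\<^sup>2) = liminf (\<lambda>n. ennreal ((cmod (g n x))\<^sup>2))"
      by (intro lim_imp_Liminf[symmetric]) auto
  qed
  also have "\<dots> \<le> liminf (\<lambda>n. \<integral>\<^sup>+x. ennreal ((cmod (g n x))\<^sup>2) \<partial>M)"
    by (intro nn_integral_liminf) measurable
  also have "\<dots> \<le> ennreal c"
  proof (rule Liminf_le)
    show "\<forall>\<^sub>F n in sequentially. (\<integral>\<^sup>+x. ennreal ((cmod (g n x))\<^sup>2) \<partial>M) \<le> ennreal c"
      using le g by (auto elim!: eventually_mono simp: square_integrable_def nn_integral_eq_integral ennreal_leI)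
  qed (rule sequentially_bot)
  finally have le': "(\<integral>\<^sup>+x. ennreal ((cmod (h x))\<^sup>2) \<partial>M) \<le> ennreal c" .
  then have "integrable M (\<lambda>x. (cmod (h x))\<^sup>2)"
    by (intro integrableI_nonneg) (auto intro: le_less_trans)
  then show "square_integrable M h" "(\<integral>x. (cmod (h x))\<^sup>2 \<partial>M) \<le> c"
    using le' c by (auto simp: square_integrable_def nn_integral_eq_integral)
qed

lemma L2_class_tendsto_dominated:
  assumes w: "square_integrable circle w" and g: "\<And>n. g n \<in> borel_measurable borel"
    and h: "h \<in> borel_measurable borel"
    and lim: "\<And>z. (\<lambda>n. g n z) \<longlonglongrightarrow> h z"
    and bound: "\<And>n z. cmod (g n z) \<le> c * cmod (w z)"
  shows "(\<lambda>n. L2_class (g n)) \<longlonglongrightarrow> L2_class h" "square_integrable circle h"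
    "\<And>n. square_integrable circle (g n)"
proof -
  note [measurable] = g h
  have bound': "cmod (h z) \<le> c * cmod (w z)" for z
    using tendsto_norm[OF lim] bound by (intro Lim_bounded[where f = "\<lambda>n. norm (g n z)"]) auto
  show sg: "square_integrable circle (g n)" for n
    by (rule square_integrable_bound[OF w _ bound]) measurable
  show sh: "square_integrable circle h"
    by (rule square_integrable_bound[OF w _ bound']) measurable
  have "(\<lambda>n. \<integral>z. (cmod (g n z - h z))\<^sup>2 \<partial>circle) \<longlonglongrightarrow> (\<integral>z. 0 \<partial>circle)"
  proof (rule integral_dominated_convergence)
    show "integrable circle (\<lambda>z. (2 * c)\<^sup>2 * (cmod (w z))\<^sup>2)"
      using w by (auto simp: square_integrable_def)
    show "AE z in circle. (\<lambda>n. (cmod (g n z - h z))\<^sup>2) \<longlonglongrightarrow> 0"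
      using lim by (intro AE_I2 tendsto_eq_intros) (auto intro!: tendsto_eq_intros)
    show "AE z in circle. norm ((cmod (g n z - h z))\<^sup>2) \<le> (2 * c)\<^sup>2 * (cmod (w z))\<^sup>2" for n
    proof (rule AE_I2)
      fix z
      have "cmod (g n z - h z) \<le> cmod (g n z) + cmod (h z)"
        by (rule norm_triangle_ineq4)
      then have "cmod (g n z - h z) \<le> 2 * c * cmod (w z)"
        using bound[of n z] bound'[of z] by linarith
      then have "(cmod (g n z - h z))\<^sup>2 \<le> (2 * c * cmod (w z))\<^sup>2"
        by (intro power_mono) auto
      then show "norm ((cmod (g n z - h z))\<^sup>2) \<le> (2 * c)\<^sup>2 * (cmod (w z))\<^sup>2"
        by (simp add: power_mult_distrib)
    qed
  qed measurable
  then have "(\<lambda>n. sqrt (\<integral>z. (cmod (g n z - h z))\<^sup>2 \<partial>circle)) \<longlonglongrightarrow> sqrt 0"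
    by (intro tendsto_real_sqrt) simp
  then have "(\<lambda>n. norm (L2_class (g n) - L2_class h)) \<longlonglongrightarrow> 0"
    by (simp add: sg sh norm_L2_class square_integrable_diff flip: L2_class_diff)
  then show "(\<lambda>n. L2_class (g n)) \<longlonglongrightarrow> L2_class h"
    by (simp only: LIM_zero_cancel tendsto_norm_zero_iff)
qed

instance circle_L2 :: banach
proof
  fix X :: "nat \<Rightarrow> circle_L2" assume X: "Cauchy X"
  have "\<exists>N. \<forall>m\<ge>N. \<forall>n\<ge>N. dist (X m) (X n) < (1/2)^k" for k
    using X by (intro metric_CauchyD) auto
  then obtain N where N: "\<And>k m n. m \<ge> N k \<Longrightarrow> n \<ge> N k \<Longrightarrow> dist (X m) (X n) < (1/2)^k"
    by metis
  define r where "r n = (\<Sum>i\<le>n. N i) + n" for n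
  have r: "strict_mono r"
    by (rule strict_monoI_Suc) (simp add: r_def)
  have rN: "r n \<ge> N n" for n
    using member_le_sum[of n "{..n}" N] by (simp add: r_def)
  have "\<exists>f. \<forall>n. square_integrable circle (f n) \<and> X n = L2_class (f n)"
    by (intro choice allI) (meson L2_class_cases)
  then obtain f where f: "\<And>n. square_integrable circle (f n)" "\<And>n. X n = L2_class (f n)"
    by metis
  have [measurable]: "f n \<in> borel_measurable borel" for n
    using f(1)[of n] by (rule square_integrable_circle_borel)
  have dist: "dist (X m) (X n) = sqrt (\<integral>z. (cmod (f m z - f n z))\<^sup>2 \<partial>circle)" for m n
    by (simp add: dist_norm f norm_L2_class square_integrable_diff flip: L2_class_diff)
  define d where "d n z = f (r (Suc n)) z - f (r n) z" for n z
  have d: "square_integrable circle (d n)" for n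
    unfolding d_def by (intro square_integrable_diff f)
  have [measurable]: "d n \<in> borel_measurable borel" for n
    using d[of n] by (rule square_integrable_circle_borel)
  have d_le: "(\<integral>z. (cmod (d n z))\<^sup>2 \<partial>circle) \<le> (1/4)^n" for n
  proof -
    have "dist (X (r (Suc n))) (X (r n)) < (1/2)^n"
      using rN[of n] strict_mono_less_eq[OF r, of n "Suc n"] by (intro N) auto
    then have "(sqrt (\<integral>z. (cmod (d n z))\<^sup>2 \<partial>circle))\<^sup>2 \<le> ((1/2)^n)\<^sup>2"
      unfolding dist d_def by (intro power_mono) (auto intro!: real_sqrt_ge_zero integral_nonneg_AE)
    also have "((1/2)^n)\<^sup>2 = (1/4::real)^n"
      by (simp add: power2_eq_square flip: power_mult_distrib)
    finally show ?thesis
      by (simp add: integral_nonneg_AE)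
  qed
  have "AE z in circle. (\<Sum>n. ennreal ((3/2)^n * (cmod (d n z))\<^sup>2)) \<noteq> \<infinity>"
  proof (rule nn_integral_PInf_AE)
    have "(\<integral>\<^sup>+z. (\<Sum>n. ennreal ((3/2)^n * (cmod (d n z))\<^sup>2)) \<partial>circle)
        = (\<Sum>n. \<integral>\<^sup>+z. ennreal ((3/2)^n * (cmod (d n z))\<^sup>2) \<partial>circle)"
      by (rule nn_integral_suminf) measurable
    also have "\<dots> = (\<Sum>n. ennreal ((3/2)^n * (\<integral>z. (cmod (d n z))\<^sup>2 \<partial>circle)))"
      using d by (intro suminf_cong) (auto simp: nn_integral_eq_integral square_integrable_def)
    also have "\<dots> \<le> (\<Sum>n. ennreal ((3/8)^n))"
    proof (intro suminf_le ennreal_leI)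
      fix n
      have "(3/2)^n * (\<integral>z. (cmod (d n z))\<^sup>2 \<partial>circle) \<le> (3/2)^n * (1/4)^n"
        by (intro mult_left_mono d_le) auto
      also have "\<dots> = (3/8)^n" by (simp flip: power_mult_distrib)
      finally show "(3/2)^n * (\<integral>z. (cmod (d n z))\<^sup>2 \<partial>circle) \<le> (3/8)^n" .
    qed auto
    also have "\<dots> = ennreal (\<Sum>n. (3/8)^n)"
      by (intro suminf_ennreal2) (auto intro!: summable_geometric)
    also have "\<dots> < \<infinity>" by simp
    finally show "(\<integral>\<^sup>+z. (\<Sum>n. ennreal ((3/2)^n * (cmod (d n z))\<^sup>2)) \<partial>circle) \<noteq> \<infinity>"
      by simp
  qed measurable
  then have conv: "AE z in circle. convergent (\<lambda>n. f (r n) z)"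
  proof eventually_elim
    fix z assume "(\<Sum>n. ennreal ((3/2)^n * (cmod (d n z))\<^sup>2)) \<noteq> \<infinity>"
    then have "summable (\<lambda>n. (3/2)^n * (cmod (d n z))\<^sup>2)"
      by (intro summable_suminf_not_top) auto
    then have "summable (\<lambda>n. (2/3)^n + (3/2)^n * (cmod (d n z))\<^sup>2)"
      by (intro summable_add summable_geometric) auto
    then have "summable (\<lambda>n. d n z)"
    proof (rule summable_comparison_test[rotated], intro exI allI impI)
      fix n
      have "2 * (cmod (d n z)) \<le> (2/3)^n + (3/2)^n * (cmod (d n z))\<^sup>2"
      proof -
        have "0 \<le> (3/2)^n * ((2/3)^n - cmod (d n z))\<^sup>2" by simp
        also have "\<dots> = ((3/2)^n * (2/3)^n) * (2/3)^n - 2 * ((3/2)^n * (2/3)^n) * cmod (d n z)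
            + (3/2)^n * (cmod (d n z))\<^sup>2"
          by (simp only: power2_eq_square) (simp add: algebra_simps)
        also have "(3/2)^n * (2/3)^n = (1::real)" by (simp flip: power_mult_distrib)
        finally show ?thesis by simp
      qed
      then show "norm (d n z) \<le> (2/3)^n + (3/2)^n * (cmod (d n z))\<^sup>2"
        using norm_ge_zero[of "d n z"] by linarith
    qed
    then have "convergent (\<lambda>n. f (r 0) z + (\<Sum>i<n. d i z))"
      by (intro convergent_add convergent_const) (simp add: summable_iff_convergent)
    also have "(\<lambda>n. f (r 0) z + (\<Sum>i<n. d i z)) = (\<lambda>n. f (r n) z)"
    proof
      show "f (r 0) z + (\<Sum>i<n. d i z) = f (r n) z" for n
        using sum_lessThan_telescope[of "\<lambda>i. f (r i) z" n]
        unfolding d_def by (metis add.commute diff_add_cancel)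
    qed
    finally show "convergent (\<lambda>n. f (r n) z)" .
  qed
  define g where "g z = lim (\<lambda>n. f (r n) z)" for z
  have [measurable]: "g \<in> borel_measurable borel"
    unfolding g_def by measurable
  have lim: "AE z in circle. (\<lambda>n. f (r n) z) \<longlonglongrightarrow> g z"
    using conv by eventually_elim (simp add: g_def convergent_LIMSEQ_iff)
  have main: "square_integrable circle (\<lambda>z. f (r m) z - g z) \<and>
      (\<integral>z. (cmod (f (r m) z - g z))\<^sup>2 \<partial>circle) \<le> (1/4)^m" for m
  proof -
    have l: "AE z in circle. (\<lambda>n. f (r m) z - f (r n) z) \<longlonglongrightarrow> f (r m) z - g z"
      using lim by eventually_elim (intro tendsto_intros)
    have e: "\<forall>\<^sub>F n in sequentially. (\<integral>z. (cmod (f (r m) z - f (r n) z))\<^sup>2 \<partial>circle) \<le> (1/4)^m"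
      using eventually_ge_at_top[of m]
    proof eventually_elim
      case (elim n)
      have "dist (X (r m)) (X (r n)) < (1/2)^m"
        using rN[of m] strict_mono_less_eq[OF r, of m n] elim by (intro N) auto
      then have "(sqrt (\<integral>z. (cmod (f (r m) z - f (r n) z))\<^sup>2 \<partial>circle))\<^sup>2 \<le> ((1/2)^m)\<^sup>2"
        unfolding dist by (intro power_mono) (auto intro!: real_sqrt_ge_zero integral_nonneg_AE)
      also have "((1/2)^m)\<^sup>2 = (1/4::real)^m"
        by (simp add: power2_eq_square flip: power_mult_distrib)
      finally show ?case
        by (simp add: integral_nonneg_AE)
    qed
    have m: "(\<lambda>z. f (r m) z - g z) \<in> borel_measurable circle"
      by measurable
    show ?thesis
      using square_integrable_Fatou[OF square_integrable_diff[OF f(1) f(1)] m l e] by blast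
  qed
  have g: "square_integrable circle g"
    using square_integrable_diff[OF f(1)[of "r 0"] conjunct1[OF main, of 0]] by simp
  have "(\<lambda>m. dist ((X \<circ> r) m) (L2_class g)) \<longlonglongrightarrow> 0"
  proof (rule tendsto_sandwich[of "\<lambda>_. 0"])
    have "sqrt (\<integral>z. (cmod (f (r m) z - g z))\<^sup>2 \<partial>circle) \<le> (1/2)^m" for m
    proof (rule real_le_lsqrt)
      show "(\<integral>z. (cmod (f (r m) z - g z))\<^sup>2 \<partial>circle) \<le> ((1/2)^m)\<^sup>2"
        using main[of m] by (simp add: power2_eq_square flip: power_mult_distrib)
    qed (auto intro!: integral_nonneg_AE)
    then show "\<forall>\<^sub>F m in sequentially. dist ((X \<circ> r) m) (L2_class g) \<le> (1/2)^m"
      by (simp add: dist_norm f g norm_L2_class square_integrable_diff flip: L2_class_diff)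
  qed (auto intro!: LIMSEQ_realpow_zero)
  then have "(X \<circ> r) \<longlonglongrightarrow> L2_class g"
    by (simp only: tendsto_dist_iff[symmetric])
  then have "X \<longlonglongrightarrow> L2_class g"
    by (rule Cauchy_converges_subseq[OF X r])
  then show "convergent X"
    by (rule convergentI)
qed

lemma closed_rational_span:
  fixes b :: "nat \<Rightarrow> 'a::real_normed_vector"
  obtains V where "closed V" "\<And>x y. x \<in> V \<Longrightarrow> y \<in> V \<Longrightarrow> x + y \<in> V"
    "\<And>c x. x \<in> V \<Longrightarrow> c *\<^sub>R x \<in> V" "\<And>n. b n \<in> V" "\<exists>Q. countable Q \<and> V = closure Q"
proof -
  define q where "q l = (\<Sum>(c, n)\<leftarrow>l. of_rat c *\<^sub>R b n)" for l :: "(rat \<times> nat) list"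
  define V where "V = closure (range q)"
  have add0: "x + y \<in> range q" if "x \<in> range q" "y \<in> range q" for x y
  proof -
    from that obtain l l' where "x = q l" "y = q l'" by auto
    then have "x + y = q (l @ l')" by (simp add: q_def)
    then show ?thesis by blast
  qed
  have scale_q: "of_rat c *\<^sub>R q l = q (map (\<lambda>(d, n). (c * d, n)) l)" for c l
    by (induction l) (auto simp: q_def scaleR_add_right of_rat_mult)
  have seqD: "\<exists>xs. (\<forall>n. xs n \<in> range q) \<and> xs \<longlonglongrightarrow> x" if "x \<in> V" for x
    using that unfolding V_def by (rule closure_sequential[THEN iffD1])
  have seqI: "x \<in> V" if "\<And>n. xs n \<in> range q" "xs \<longlonglongrightarrow> x" for x and xs :: "nat \<Rightarrow> 'a"
    unfolding V_def by (rule closure_sequential[THEN iffD2]) (use that in blast)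
  have add: "x + y \<in> V" if "x \<in> V" "y \<in> V" for x y
  proof -
    from seqD[OF that(1)] seqD[OF that(2)] obtain xs ys where
      *: "\<And>n. xs n \<in> range q" "xs \<longlonglongrightarrow> x" "\<And>n. ys n \<in> range q" "ys \<longlonglongrightarrow> y"
      by metis
    show ?thesis
      by (rule seqI[of "\<lambda>n. xs n + ys n"]) (intro add0 tendsto_add *)+
  qed
  have scale: "c *\<^sub>R x \<in> V" if "x \<in> V" for c x
  proof -
    have rat: "of_rat c *\<^sub>R x \<in> V" for c
    proof -
      from seqD[OF that] obtain xs where xs: "\<And>n. xs n \<in> range q" "xs \<longlonglongrightarrow> x"
        by metis
      show ?thesis
      proof (rule seqI)
        show "of_rat c *\<^sub>R xs n \<in> range q" for n
          using xs(1)[of n] scale_q[of c] by force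
        show "(\<lambda>n. of_rat c *\<^sub>R xs n) \<longlonglongrightarrow> of_rat c *\<^sub>R x"
          by (rule tendsto_scaleR[OF tendsto_const xs(2)])
      qed
    qed
    have "\<exists>p. c < of_rat p \<and> of_rat p < c + 1 / real (Suc n)" for n
      by (rule of_rat_dense) auto
    then obtain p where p: "\<And>n. c < of_rat (p n)" "\<And>n. of_rat (p n) < c + 1 / real (Suc n)"
      by metis
    have "(\<lambda>n. of_rat (p n)) \<longlonglongrightarrow> c"
    proof (rule tendsto_sandwich[of "\<lambda>_. c" _ _ "\<lambda>n. c + 1 / real (Suc n)"])
      show "(\<lambda>n. c + 1 / real (Suc n)) \<longlonglongrightarrow> c"
        using tendsto_add[OF tendsto_const[of c] LIMSEQ_Suc[OF lim_1_over_n]] by simp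
      show "\<forall>\<^sub>F n in sequentially. c \<le> of_rat (p n)"
        using p(1) by (intro always_eventually allI less_imp_le)
      show "\<forall>\<^sub>F n in sequentially. of_rat (p n) \<le> c + 1 / real (Suc n)"
        using p(2) by (intro always_eventually allI less_imp_le)
    qed (rule tendsto_const)
    then have "(\<lambda>n. of_rat (p n) *\<^sub>R x) \<longlonglongrightarrow> c *\<^sub>R x"
      by (rule tendsto_scaleR[OF _ tendsto_const])
    with _ rat show ?thesis
      by (rule closed_sequentially) (simp add: V_def)
  qed
  have "b n \<in> V" for n
  proof -
    have "b n = q [(1, n)]" by (simp add: q_def)
    then show ?thesis unfolding V_def by (metis closure_subset rangeI subsetD)
  qed
  moreover have "closed V" "countable (range q)"
    by (simp_all add: V_def)
  ultimately show ?thesis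
    using add scale V_def by (intro that[of V]) blast+
qed

lemma circle_L2_separable: "\<exists>Q :: circle_L2 set. countable Q \<and> closure Q = UNIV"
proof -
  obtain B :: "complex set set" where B: "countable B" "topological_basis B"
    using ex_countable_basis by blast
  define G where "G = insert {} (Union ` {F. finite F \<and> F \<subseteq> B})"
  define I where "I c A = L2_class (\<lambda>z. c * indicator A z)" for c :: complex and A
  define b where "b = from_nat_into ((\<lambda>(c, A). I c A) ` ({1, \<i>} \<times> G))"
  have "countable G"
    unfolding G_def using countable_Collect_finite_subset[OF B(1)] by auto
  then have range_b: "range b = (\<lambda>(c, A). I c A) ` ({1, \<i>} \<times> G)"
    unfolding b_def by (intro range_from_nat_into) (auto simp: G_def)
  obtain V where V: "closed V" "\<And>x y. x \<in> V \<Longrightarrow> y \<in> V \<Longrightarrow> x + y \<in> V"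
    "\<And>c x. x \<in> V \<Longrightarrow> c *\<^sub>R x \<in> V" "\<And>n. b n \<in> V" "\<exists>Q. countable Q \<and> V = closure Q"
    using closed_rational_span[of b] by metis
  have one: "square_integrable circle (\<lambda>_. 1)"
    by (simp add: square_integrable_def)
  have ind: "square_integrable circle (\<lambda>z. c * indicator A z)" if [measurable]: "A \<in> sets borel" for c A
    by (rule square_integrable_cmult, rule square_integrable_bound[OF one, where c = 1])
      (auto simp: indicator_def)
  have I_disj: "I c (A \<union> B) = I c A + I c B"
    if "A \<in> sets borel" "B \<in> sets borel" "A \<inter> B = {}" for c A B
  proof -
    have "(\<lambda>z. c * indicator (A \<union> B) z) = (\<lambda>z. c * indicator A z + c * indicator B z)"
      using that(3) by (auto simp: fun_eq_iff indicator_def)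
    then show ?thesis
      unfolding I_def by (simp only: L2_class_add ind that)
  qed
  have lim: "I c (\<Union>i. A i) \<in> V"
    if A: "incseq A" "\<And>i. A i \<in> sets borel" "\<And>i. I c (A i) \<in> V" for A :: "nat \<Rightarrow> complex set" and c
  proof -
    have "(\<lambda>n. I c (A n)) \<longlonglongrightarrow> I c (\<Union>i. A i)"
      unfolding I_def
    proof (rule L2_class_tendsto_dominated(1)[OF square_integrable_cmult[OF one, of c], where c = 1])
      show "(\<lambda>n. c * indicator (A n) z) \<longlonglongrightarrow> c * indicator (\<Union>i. A i) z" for z
        using A(1) by (intro tendsto_mult tendsto_const LIMSEQ_indicator_incseq)
      show "(\<lambda>z. c * indicator (A n) z) \<in> borel_measurable borel" for n
        using A(2) by measurable
      show "(\<lambda>z. c * indicator (\<Union>i. A i) z) \<in> borel_measurable borel"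
        using A(2) by measurable
    qed (auto simp: indicator_def)
    with V(1) A(3) show ?thesis
      by (rule closed_sequentially)
  qed
  have zero: "0 \<in> V"
    using V(3)[OF V(4), of 0] by simp
  have G: "I c A \<in> V" if "A \<in> G" "c \<in> {1, \<i>}" for c A
  proof -
    have "I c A \<in> range b" unfolding range_b using that by auto
    then show ?thesis using V(4) by auto
  qed
  have "open A" if "A \<in> G" for A
    using that B(2) by (auto simp: G_def topological_basis_def intro!: open_Union)
  have opn: "I c U \<in> V" if U: "open U" "c \<in> {1, \<i>}" for c U
  proof (cases "U = {}")
    case True
    then show ?thesis using G[of "{}"] U(2) by (simp add: G_def)
  next
    case False
    obtain B' where B': "B' \<subseteq> B" "\<Union>B' = U"
      using B(2) U(1) by (auto simp: topological_basis_def)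
    with False have ne: "B' \<noteq> {}" by auto
    have cB': "countable B'" using B(1) B'(1) countable_subset by blast
    define A where "A n = (\<Union>i<n. from_nat_into B' i)" for n :: nat
    have AG: "A n \<in> G" for n
      unfolding G_def A_def using from_nat_into[OF ne] B'(1)
      by (intro insertI2 image_eqI[of _ _ "from_nat_into B' ` {..<n}"]) auto
    have "I c (\<Union>i. A i) \<in> V"
    proof (rule lim)
      show "incseq A" by (unfold A_def, intro monoI UN_mono) auto
      show "A i \<in> sets borel" for i
        using AG[of i] \<open>\<And>A. A \<in> G \<Longrightarrow> open A\<close> by auto
      show "I c (A i) \<in> V" for i
        using AG U(2) by (rule G)
    qed
    also have "(\<Union>i. A i) = U"
    proof -
      have "(\<Union>i. A i) = \<Union> (range (from_nat_into B'))"
        unfolding A_def by (rule UN_UN_finite_eq[unfolded atLeast0LessThan])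
      then show ?thesis
        using range_from_nat_into[OF ne cB'] B'(2) by simp
    qed
    finally show ?thesis .
  qed
  have borel: "I c A \<in> V" if A: "A \<in> sets borel" and c: "c \<in> {1, \<i>}" for c A
  proof -
    have A': "A \<in> sigma_sets UNIV {S. open S}"
      using A by (simp add: borel_def)
    have ist: "Int_stable {S :: complex set. open S}" "{S :: complex set. open S} \<subseteq> Pow UNIV"
      by (auto simp: Int_stable_def)
    from ist(1) ist(2) A' show ?thesis
    proof (induction rule: sigma_sets_induct_disjoint)
      case (basic A)
      then show ?case using opn c by auto
    next
      case empty
      then show ?case using opn[of "{}"] c by auto
    next
      case (compl A)
      then have [measurable]: "A \<in> sets borel" by (simp add: borel_def)
      have "I c UNIV = I c (UNIV - A) + I c A"
        using I_disj[of "UNIV - A" A c, OF _ _ Diff_disjoint[THEN trans[OF Int_commute]]] by simp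
      then have "I c (UNIV - A) = I c UNIV + (-1) *\<^sub>R I c A"
        by simp
      then show ?case using V(2)[OF opn[OF open_UNIV c] V(3)[OF compl(2)]] by metis
    next
      case (union A)
      then have m: "A i \<in> sets borel" for i by (auto simp: borel_def)
      have *: "I c (\<Union>i<n. A i) \<in> V" for n
      proof (induction n)
        case 0
        then show ?case using opn[of "{}"] c by auto
      next
        case (Suc n)
        have "A i \<inter> A n = {}" if "i < n" for i
          using union(1) that by (simp add: disjoint_family_on_def)
        then have "(\<Union>i<n. A i) \<inter> A n = {}"
          by (auto 0 0) (metis IntI emptyE)
        then have "I c (\<Union>i<Suc n. A i) = I c (\<Union>i<n. A i) + I c (A n)"
          using I_disj[of "\<Union>i<n. A i" "A n" c] m by (auto simp: lessThan_Suc Un_commute)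
        then show ?case using V(2) Suc union by auto
      qed
      have "I c (\<Union>n. \<Union>i<n. A i) \<in> V"
        by (rule lim) (auto intro!: incseq_SucI * m simp: less_Suc_eq)
      also have "(\<Union>n. \<Union>i<n. A i) = (\<Union>i. A i)"
        by (rule UN_UN_finite_eq[unfolded atLeast0LessThan])
      finally show ?case .
    qed
  qed
  have borel': "I c A \<in> V" if A: "A \<in> sets borel" for c A
  proof -
    have "I c A = Re c *\<^sub>R I 1 A + Im c *\<^sub>R I \<i> A"
    proof -
      have "(\<lambda>z. c * indicator A z) =
          (\<lambda>z. Re c *\<^sub>R (1 * indicator A z) + Im c *\<^sub>R (\<i> * indicator A z))"
        by (auto simp: fun_eq_iff indicator_def complex_eq_iff)
      then show ?thesis
        unfolding I_def by (simp only: L2_class_add L2_class_scaleR square_integrable_scaleR ind[OF A])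
    qed
    then show ?thesis
      using V(2)[OF V(3)[OF borel[OF A]] V(3)[OF borel[OF A]], of 1 \<i>] by simp
  qed
  have "F \<in> V" for F
  proof -
    obtain f where f: "square_integrable circle f" "F = L2_class f"
      by (rule L2_class_cases)
    then have "f \<in> borel_measurable borel"
      by (intro square_integrable_circle_borel)
    from borel_measurable_implies_sequence_metric[OF this, of 0] obtain s
      where s: "\<And>i. simple_function borel (s i)" "\<And>z. (\<lambda>i. s i z) \<longlonglongrightarrow> f z"
        "\<And>i z. cmod (s i z) \<le> 2 * cmod (f z)"
      by (auto simp: space_borel)
    have "(\<lambda>i. L2_class (s i)) \<longlonglongrightarrow> L2_class f"
      using s \<open>f \<in> borel_measurable borel\<close>
      by (intro L2_class_tendsto_dominated(1)[OF f(1)]) (auto intro: borel_measurable_simple_function)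
    moreover have "L2_class (s i) \<in> V" for i
    proof -
      have fin: "finite (range (s i))"
        using s(1)[of i] by (simp add: simple_function_def)
      have m: "s i -` {y} \<in> sets borel" for y
        using simple_functionD(2)[OF s(1), of i "{y}"] by simp
      have "L2_class (\<lambda>z. \<Sum>y\<in>Y. y * indicator (s i -` {y}) z) \<in> V \<and>
          square_integrable circle (\<lambda>z. \<Sum>y\<in>Y. y * indicator (s i -` {y}) z)"
        if "finite Y" for Y
        using that
      proof induction
        case empty
        then show ?case using zero by (simp add: L2_class_zero square_integrable_zero)
      next
        case (insert y Y)
        then have ih: "L2_class (\<lambda>z. \<Sum>y\<in>Y. y * indicator (s i -` {y}) z) \<in> V"
            "square_integrable circle (\<lambda>z. \<Sum>y\<in>Y. y * indicator (s i -` {y}) z)"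
          by blast+
        show ?case
          unfolding sum.insert[OF insert(1,2)] L2_class_add[OF ind[OF m] ih(2)]
          using V(2)[OF borel'[OF m] ih(1)] square_integrable_add[OF ind[OF m] ih(2)]
          unfolding I_def by blast
      qed
      moreover have "(\<lambda>z. \<Sum>y\<in>range (s i). y * indicator (s i -` {y}) z) = s i"
      proof
        fix z
        have "(\<Sum>y\<in>range (s i). y * indicator (s i -` {y}) z)
            = (\<Sum>y\<in>range (s i). if s i z = y then y else 0)"
          by (intro sum.cong) (auto simp: indicator_def)
        then show "(\<Sum>y\<in>range (s i). y * indicator (s i -` {y}) z) = s i z"
          using fin by (simp add: sum.delta')
      qed
      ultimately show ?thesis
        using fin by metis
    qed
    ultimately show ?thesis
      unfolding f(2) by (rule closed_sequentially[OF V(1), rotated])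
  qed
  then show ?thesis using V(5) by auto
qed

instance circle_L2 :: second_countable_topology
proof
  obtain Q :: "circle_L2 set" where Q: "countable Q" "closure Q = UNIV"
    using circle_L2_separable by blast
  define B where "B = (\<lambda>(x, n). ball x (1 / real (Suc n))) ` (Q \<times> UNIV)"
  have "topological_basis B"
  proof (rule topological_basisI)
    fix U and x :: circle_L2 assume "open U" "x \<in> U"
    then obtain e where e: "e > 0" "ball x e \<subseteq> U"
      using open_contains_ball by blast
    then obtain n where n: "1 / real (Suc n) < e / 2"
      using nat_approx_posE[of "e / 2"] by auto
    have "x \<in> closure Q" using Q(2) by simp
    then obtain y where y: "y \<in> Q" "dist y x < 1 / real (Suc n)"
      unfolding closure_approachable by (meson of_nat_0_less_iff zero_less_Suc zero_less_divide_1_iff)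
    have "ball y (1 / real (Suc n)) \<subseteq> ball x e"
    proof
      fix z assume "z \<in> ball y (1 / real (Suc n))"
      then have "dist x z < e"
        using dist_triangle[of x z y] y(2) n by (simp add: dist_commute)
      then show "z \<in> ball x e" by simp
    qed
    then show "\<exists>B'\<in>B. x \<in> B' \<and> B' \<subseteq> U"
      using y e(2) by (intro bexI[of _ "ball y (1 / real (Suc n))"]) (auto simp: B_def)
  qed (auto simp: B_def)
  moreover have "countable B"
    using Q(1) by (auto simp: B_def)
  ultimately show "\<exists>B :: circle_L2 set set. countable B \<and> open = generate_topology B"
    using topological_basis_imp_subbasis by blast
qed

lemma powi_borel_measurable [measurable]: "(\<lambda>z :: complex. z powi n) \<in> borel_measurable borel"
  by (cases "n \<ge> 0") (simp_all add: power_int_def)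

text \<open>On the circle, \<open>z powi (-n)\<close> is \<open>exp (- \<i> * n * x)\<close> for \<open>z = cis x\<close>.\<close>

lift_definition fourier_coeff :: "circle_L2 \<Rightarrow> int \<Rightarrow> complex"
  is "\<lambda>f n. \<integral>z. f z * z powi (- n) \<partial>circle"
  by (rule ext, rule integral_cong_AE) (auto simp: circle_eq_def square_integrable_def)

text \<open>The infinite sums below are unconditional sums in \<open>L\<^sup>2\<close>.\<close>

definition riesz_projector :: "circle_L2 \<Rightarrow> circle_L2" where
  "riesz_projector f = (\<Sum>\<^sub>\<infinity>n\<in>{0..}. L2_class (\<lambda>z. fourier_coeff f n * z powi n))"

definition hardy_space :: "circle_L2 set" where
  "hardy_space = range riesz_projector"

definition half_heat_semigroup :: "real \<Rightarrow> circle_L2 \<Rightarrow> circle_L2" where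
  "half_heat_semigroup t f =
     (\<Sum>\<^sub>\<infinity>n. L2_class (\<lambda>z. fourier_coeff f n * of_real (exp (- (real_of_int \<bar>n\<bar> * t))) * z powi n))"

definition extend_by_zero :: "complex set \<Rightarrow> (complex \<Rightarrow> complex) \<Rightarrow> circle_L2" where
  "extend_by_zero \<omega> v = L2_class (\<lambda>z. if z \<in> \<omega> then v z else 0)"

text \<open>The integral is the Bochner integral in \<open>L\<^sup>2\<close>. For a square integrable control \<open>u\<close>, the
  function \<open>\<lambda>z. u (s, z)\<close> is square integrable on \<open>\<omega>\<close> for almost every \<open>s\<close>.\<close>

definition mild_solution ::
    "complex set \<Rightarrow> circle_L2 \<Rightarrow> (real \<times> complex \<Rightarrow> complex) \<Rightarrow> real \<Rightarrow> circle_L2" where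
  "mild_solution \<omega> f\<^sub>0 u t = half_heat_semigroup t f\<^sub>0 +
     (LINT s:{0..t}|lborel.
        half_heat_semigroup (t - s) (riesz_projector (extend_by_zero \<omega> (\<lambda>z. u (s, z)))))"

definition null_controllable :: "complex set \<Rightarrow> real \<Rightarrow> circle_L2 set" where
  "null_controllable \<omega> T = {f\<^sub>0 \<in> hardy_space.
     \<exists>u. square_integrable (restrict_space (lborel \<Otimes>\<^sub>M circle) ({0..T} \<times> \<omega>)) u \<and>
       mild_solution \<omega> f\<^sub>0 u T = 0}"

definition sobolev_space :: "nat \<Rightarrow> circle_L2 set" where
  "sobolev_space k =
     {f. (\<lambda>n. (1 + (real_of_int n)\<^sup>2) ^ k * (cmod (fourier_coeff f n))\<^sup>2) summable_on UNIV}"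

definition sobolev_inner :: "nat \<Rightarrow> circle_L2 \<Rightarrow> circle_L2 \<Rightarrow> complex" where
  "sobolev_inner k f g =
     (\<Sum>\<^sub>\<infinity>n. of_real ((1 + (real_of_int n)\<^sup>2) ^ k) * fourier_coeff f n * cnj (fourier_coeff g n))"

definition sobolev_norm :: "nat \<Rightarrow> circle_L2 \<Rightarrow> real" where
  "sobolev_norm k f = sqrt (Re (sobolev_inner k f f))"

definition open_strict_interval :: "complex set \<Rightarrow> bool" where
  "open_strict_interval \<omega> \<longleftrightarrow> (\<exists>a b. 0 < b - a \<and> b - a < 2 * pi \<and> \<omega> = cis ` {a<..<b})"

end

theory Submission
  imports Defs "HOL-Complex_Analysis.Conformal_Mappings"
begin

text \<open>If \<open>v\<close> is supported in \<open>\<omega>\<close> together with its derivative \<open>v'\<close>, then \<open>P\<^sub>+ v\<close> is null-controllable: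
  \<open>(1 - s / T) P\<^sub>+ v\<close> solves the control system with control \<open>- v / T - \<i> (1 - s / T) v'\<close>, because
  \<open>|D| P\<^sub>+ v = - \<i> P\<^sub>+ v'\<close>.

  Such \<open>P\<^sub>+ v\<close> are dense. Let \<open>d\<close> be orthogonal to all of them for the Sobolev scalar product, and
  test against the translates by \<open>y\<close> of \<open>exp (\<i> j x) Q x\<close> for a bump \<open>Q \<ge> 0\<close> of small support.
  Orthogonality says that an absolutely convergent power series with \<open>j\<close>-th coefficient a nonzero
  multiple of the conjugate of \<open>fourier_coeff d j\<close> vanishes at \<open>exp (- \<i> y)\<close> for all \<open>y\<close> in an
  interval. A power series that vanishes on an arc of the circle is zero.\<close>

section \<open>Fourier modes on the circle\<close>

text \<open>The Riesz projector is what makes density possible. It leaves only frequencies n >= 0,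
  so orthogonality produces a power series; a two-sided series in z and 1/z may vanish on an arc
  without being zero. A single bump might have vanishing Fourier coefficients. Modulation by
  exp(\<i> j x) avoids this: frequency j of the product is frequency 0 of the bump, the integral of
  a nonnegative function. The bump is t (\<delta> - t) to the power k + 1, cut off to [0, \<delta>]:
  smooth enough for order k, and its derivatives remain cut-off polynomials.
  \<open>circle_L2\<close> carries only a real scalar product, and its norm is not the Sobolev norm.
  The first defect is met by letting the test functions be multiplied by \<i>, which recovers
  imaginary parts; the second by \<open>sobolev_lift\<close>, an isometry of the Sobolev space into
  \<open>circle_L2\<close>, where the orthogonal projection takes place.\<close>

lemma circle_integral:
  fixes f :: "complex \<Rightarrow> 'b::{banach, second_countable_topology}"
  assumes [measurable]: "f \<in> borel_measurable borel"
  shows "(\<integral>z. f z \<partial>circle) = (\<integral>x. (indicator {0..<2 * pi} x / (2 * pi)) *\<^sub>R f (cis x) \<partial>lborel)"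
proof -
  have [measurable]: "cis \<in> borel_measurable borel"
    by (rule cis_measurable)
  have "ennreal (2 * pi) = 2 * ennreal pi"
    by (simp add: ennreal_mult)
  then have d: "uniform_measure lborel {0..<2 * pi} =
      density lborel (\<lambda>x. ennreal (indicator {0..<2 * pi} x / (2 * pi)))"
    unfolding uniform_measure_def
    by (intro arg_cong[where f = "density lborel"] ext)
      (auto simp: indicator_def divide_ennreal[symmetric] ennreal_mult)
  have "(\<integral>z. f z \<partial>circle) = (\<integral>x. f (cis x) \<partial>uniform_measure lborel {0..<2 * pi})"
    unfolding circle_def by (rule integral_distr) measurable
  also have "\<dots> = (\<integral>x. (indicator {0..<2 * pi} x / (2 * pi)) *\<^sub>R f (cis x) \<partial>lborel)"
    unfolding d by (rule integral_density) auto
  finally show ?thesis .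
qed

text \<open>Functions live on the whole plane, whereas rules such as cnj z = 1 / z hold on the
  circle; this is why integrands are later compared almost everywhere.\<close>

lemma AE_circle_norm: "AE z in circle. cmod z = 1"
proof -
  have "cis \<in> measurable (uniform_measure lborel {0..<2 * pi}) borel"
    using cis_measurable by simp
  then show ?thesis
    unfolding circle_def by (subst AE_distr_iff) auto
qed

lemma square_integrable_AE_bounded:
  assumes "f \<in> borel_measurable borel" "AE z in circle. cmod (f z) \<le> B"
  shows "square_integrable circle f"
  unfolding square_integrable_def
proof
  show m: "f \<in> borel_measurable circle"
    using assms(1) by simp
  have "AE z in circle. norm ((cmod (f z))\<^sup>2) \<le> B\<^sup>2"
    using assms(2) by eventually_elim (simp add: power_mono)
  then show "integrable circle (\<lambda>z. (cmod (f z))\<^sup>2)"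
    using m by (intro circle.integrable_const_bound) auto
qed

lemma square_integrable_powi: "square_integrable circle (\<lambda>z. c * z powi n)"
proof (rule square_integrable_AE_bounded)
  show "AE z in circle. cmod (c * z powi n) \<le> cmod c"
    using AE_circle_norm by eventually_elim (simp add: norm_mult norm_power_int)
qed measurable

lemma cis_powi: "cis x powi n = cis (of_int n * x)"
  by (cases "n \<ge> 0") (simp_all add: power_int_def Complex.DeMoivre)

lemma exp_has_vector_derivative:
  "((\<lambda>x. exp (c * complex_of_real x)) has_vector_derivative c * exp (c * of_real x)) (at x within S)"
  by (rule has_vector_derivative_real_field) (auto intro!: derivative_eq_intros)

lemma cis_conv_exp': "cis (of_int n * x) = exp (\<i> * of_int n * of_real x)"
  by (simp add: cis_conv_exp mult.assoc)

lemma integral_cis_int: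
  assumes "n \<noteq> (0::int)"
  shows "(\<integral>x. indicator {0..2 * pi} x *\<^sub>R cis (of_int n * x) \<partial>lborel) = 0"
proof -
  have "(\<integral>x. indicator {0..2 * pi} x *\<^sub>R cis (of_int n * x) \<partial>lborel)
      = cis (of_int n * (2 * pi)) / (\<i> * of_int n) - cis (of_int n * 0) / (\<i> * of_int n)"
  proof (rule integral_FTC_atLeastAtMost)
    fix x :: real
    show "((\<lambda>x. cis (of_int n * x) / (\<i> * of_int n)) has_vector_derivative cis (of_int n * x))
        (at x within {0..2 * pi})"
      using has_vector_derivative_divide[OF exp_has_vector_derivative[of "\<i> * of_int n" x "{0..2 * pi}"],
          of "\<i> * of_int n"] assms
      by (simp add: cis_conv_exp')
  qed (auto intro!: continuous_intros)
  also have "cis (of_int n * (2 * pi)) = 1"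
    by (metis cis_multiple_2pi Ints_of_int mult.commute)
  finally show ?thesis by simp
qed

lemma integral_circle_powi: "(\<integral>z. z powi n \<partial>circle) = (if n = 0 then 1 else 0)"
proof -
  have "(\<integral>z. z powi n \<partial>circle) = (\<integral>x. (indicator {0..<2 * pi} x / (2 * pi)) *\<^sub>R cis (of_int n * x) \<partial>lborel)"
    by (subst circle_integral) (auto simp: cis_powi)
  \<comment> \<open>The end point 2 pi, a null set, is added so that the fundamental theorem of
    calculus applies on a closed interval.\<close>
  also have "\<dots> = (\<integral>x. (1 / (2 * pi)) *\<^sub>R (indicator {0..2 * pi} x *\<^sub>R cis (of_int n * x)) \<partial>lborel)"
  proof (rule integral_cong_AE)
    show "AE x in lborel. (indicator {0..<2 * pi} x / (2 * pi)) *\<^sub>R cis (of_int n * x) =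
        (1 / (2 * pi)) *\<^sub>R (indicator {0..2 * pi} x *\<^sub>R cis (of_int n * x))"
      using AE_lborel_singleton[of "2 * pi"] by eventually_elim (auto simp: indicator_def)
  qed (use cis_measurable in measurable)
  also have "\<dots> = (1 / (2 * pi)) *\<^sub>R (\<integral>x. indicator {0..2 * pi} x *\<^sub>R cis (of_int n * x) \<partial>lborel)"
    by (rule integral_scaleR_right)
  also have "\<dots> = (if n = 0 then 1 else 0)"
  proof (cases "n = 0")
    case True
    then show ?thesis by (simp add: scaleR_conv_of_real)
  next
    case False
    then show ?thesis using integral_cis_int[OF False] by simp
  qed
  finally show ?thesis .
qed

lemma fourier_coeff_L2_class:
  "square_integrable circle f \<Longrightarrow> fourier_coeff (L2_class f) n = (\<integral>z. f z * z powi (- n) \<partial>circle)"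
  by transfer simp

lemma inner_L2_class:
  "square_integrable circle f \<Longrightarrow> square_integrable circle g \<Longrightarrow>
    inner (L2_class f) (L2_class g) = (\<integral>z. Re (f z * cnj (g z)) \<partial>circle)"
  by transfer simp

text \<open>The coefficient is built in because \<open>circle_L2\<close> has only real scalars; as a
  function of \<open>c\<close> the mode is real linear and isometric.\<close>

definition fourier_mode :: "int \<Rightarrow> complex \<Rightarrow> circle_L2" where
  "fourier_mode n c = L2_class (\<lambda>z. c * z powi n)"

lemma cnj_powi_circle: "cmod z = 1 \<Longrightarrow> cnj (z powi n) = z powi (- n)"
  using complex_norm_eq_1_exp[of z] cis_powi[of "Arg2pi z"]
  by (simp add: cis_conv_exp[symmetric] cis_cnj)

lemma inner_fourier_mode: "inner f (fourier_mode n c) = Re (fourier_coeff f n * cnj c)"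
proof -
  obtain g where g: "square_integrable circle g" "f = L2_class g"
    by (rule L2_class_cases)
  have [measurable]: "g \<in> borel_measurable borel"
    using g(1) by (rule square_integrable_circle_borel)
  have int: "integrable circle (\<lambda>z. g z * cnj (c * z powi n))"
    by (intro square_integrable_mult g square_integrable_cnj square_integrable_powi)
  have eq: "AE z in circle. g z * cnj (c * z powi n) = (g z * z powi (- n)) * cnj c"
    using AE_circle_norm by eventually_elim (simp add: cnj_powi_circle del: complex_cnj_power_int)
  have "inner f (fourier_mode n c) = (\<integral>z. Re (g z * cnj (c * z powi n)) \<partial>circle)"
    unfolding g(2) fourier_mode_def by (intro inner_L2_class g square_integrable_powi)
  also have "\<dots> = Re (\<integral>z. g z * cnj (c * z powi n) \<partial>circle)"
    using int by (rule integral_Re)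
  also have "(\<integral>z. g z * cnj (c * z powi n) \<partial>circle) = (\<integral>z. (g z * z powi (- n)) * cnj c \<partial>circle)"
    using eq borel_measurable_integrable[OF int]
    by (intro integral_cong_AE) (simp_all del: complex_cnj_mult)
  also have "\<dots> = fourier_coeff f n * cnj c"
    unfolding g(2) by (simp add: fourier_coeff_L2_class g)
  finally show ?thesis .
qed

lemma fourier_coeff_mode: "fourier_coeff (fourier_mode n c) m = (if m = n then c else 0)"
proof -
  have "fourier_coeff (fourier_mode n c) m = (\<integral>z. c * z powi n * z powi (- m) \<partial>circle)"
    unfolding fourier_mode_def by (intro fourier_coeff_L2_class square_integrable_powi)
  also have "\<dots> = (\<integral>z. c * z powi (n - m) \<partial>circle)"
  proof (rule integral_cong_AE)
    show "AE z in circle. c * z powi n * z powi (- m) = c * z powi (n - m)"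
      using AE_circle_norm
    proof eventually_elim
      case (elim z)
      then have "z \<noteq> 0" by auto
      then show ?case by (simp add: power_int_diff power_int_minus field_simps)
    qed
  qed measurable
  also have "\<dots> = (if m = n then c else 0)"
    by (simp add: integral_circle_powi)
  finally show ?thesis .
qed

lemma bounded_linear_fourier_mode: "bounded_linear (fourier_mode n)"
proof (rule bounded_linear_intro)
  fix c d :: complex and r :: real
  show "fourier_mode n (c + d) = fourier_mode n c + fourier_mode n d"
    unfolding fourier_mode_def
    by (simp add: distrib_right square_integrable_powi flip: L2_class_add)
  show "fourier_mode n (r *\<^sub>R c) = r *\<^sub>R fourier_mode n c"
    unfolding fourier_mode_def
    by (simp add: square_integrable_powi flip: L2_class_scaleR)
  show "norm (fourier_mode n c) \<le> norm c * 1"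
    by (simp add: norm_eq_sqrt_inner[of "fourier_mode n c"] inner_fourier_mode fourier_coeff_mode
        cmod_def power2_eq_square)
qed

lemma norm_fourier_mode: "norm (fourier_mode n c) = cmod c"
  by (simp add: norm_eq_sqrt_inner[of "fourier_mode n c"] inner_fourier_mode fourier_coeff_mode
      cmod_def power2_eq_square)

lemma Re_fourier_coeff: "Re (fourier_coeff f n) = inner f (fourier_mode n 1)"
  and Im_fourier_coeff: "Im (fourier_coeff f n) = inner f (fourier_mode n \<i>)"
  by (simp_all add: inner_fourier_mode)

text \<open>A real scalar product sees only real parts; testing against the modes with coefficients
  1 and \<i> recovers the whole coefficient from two continuous functionals.\<close>

lemma bounded_linear_fourier_coeff: "bounded_linear (\<lambda>f. fourier_coeff f n)"
proof -
  have "fourier_coeff f n = inner f (fourier_mode n 1) *\<^sub>R 1 + inner f (fourier_mode n \<i>) *\<^sub>R \<i>" for f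
    by (simp add: complex_eq_iff Re_fourier_coeff Im_fourier_coeff)
  then show ?thesis
    by (simp only:) (intro bounded_linear_add bounded_linear_scaleR_const bounded_linear_inner_left)
qed

section \<open>Fourier series in the space \<open>L\<^sup>2\<close>\<close>

text \<open>By Pythagoras, enlarging a finite index set changes the partial sum by a vector whose
  squared norm is a piece of the tail of the squared norms. The net of partial sums is therefore
  Cauchy, and the space is complete.\<close>

lemma summable_on_orthogonal:
  fixes f :: "'i \<Rightarrow> 'a::{real_inner, banach}"
  assumes orth: "pairwise (\<lambda>i j. orthogonal (f i) (f j)) A"
    and sum: "(\<lambda>i. (norm (f i))\<^sup>2) summable_on A"
  shows "f summable_on A"
proof -
  have "\<exists>P. eventually P (finite_subsets_at_top A) \<and> (\<forall>F F'. P F \<and> P F' \<longrightarrow> dist (sum f F) (sum f F') < e)"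
    if e: "e > 0" for e
  proof -
    define L where "L = (\<Sum>\<^sub>\<infinity>i\<in>A. (norm (f i))\<^sup>2)"
    obtain F0 where F0: "finite F0" "F0 \<subseteq> A" "dist (\<Sum>i\<in>F0. (norm (f i))\<^sup>2) L \<le> (e / 3)\<^sup>2"
      using infsum_finite_approximation[OF sum, of "(e / 3)\<^sup>2"] e unfolding L_def by auto
    define P where "P F \<longleftrightarrow> finite F \<and> F0 \<subseteq> F \<and> F \<subseteq> A" for F
    have ev: "eventually P (finite_subsets_at_top A)"
      unfolding eventually_finite_subsets_at_top P_def using F0 by blast
    have close: "dist (sum f F) (sum f F0) \<le> e / 3" if "P F" for F
    proof (rule power2_le_imp_le)
      have F: "finite F" "F0 \<subseteq> F" "F \<subseteq> A"
        using that by (auto simp: P_def)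
      have "(dist (sum f F) (sum f F0))\<^sup>2 = (norm (sum f (F - F0)))\<^sup>2"
        using F F0(1) by (simp add: dist_norm sum_diff)
      also have "\<dots> = (\<Sum>i\<in>F - F0. (norm (f i))\<^sup>2)"
        using F by (intro norm_sum_Pythagorean pairwise_subset[OF orth]) auto
      also have "\<dots> = (\<Sum>i\<in>F. (norm (f i))\<^sup>2) - (\<Sum>i\<in>F0. (norm (f i))\<^sup>2)"
        using F by (simp add: sum_diff finite_subset)
      also have "(\<Sum>i\<in>F. (norm (f i))\<^sup>2) \<le> L"
        unfolding L_def using F sum by (intro finite_sum_le_infsum) auto
      also have "L - (\<Sum>i\<in>F0. (norm (f i))\<^sup>2) \<le> (e / 3)\<^sup>2"
        using F0(3) by (simp add: dist_real_def)
      finally show "(dist (sum f F) (sum f F0))\<^sup>2 \<le> (e / 3)\<^sup>2"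
        by simp
    qed (use e in auto)
    have "dist (sum f F) (sum f F') < e" if "P F" "P F'" for F F'
      using close[OF that(1)] close[OF that(2)] dist_triangle2[of "sum f F" "sum f F'" "sum f F0"] e
      by linarith
    then show ?thesis
      using ev by blast
  qed
  then have "cauchy_filter (filtermap (sum f) (finite_subsets_at_top A))"
    by (simp add: cauchy_filter_metric_filtermap)
  moreover have "complete (UNIV::'a set)"
    by (meson Cauchy_convergent UNIV_I complete_def convergent_def)
  ultimately obtain L' where "(sum f \<longlongrightarrow> L') (finite_subsets_at_top A)"
    using complete_uniform[where S = UNIV] by (force simp add: filterlim_def)
  then show ?thesis
    using summable_on_def has_sum_def by blast
qed

abbreviation ell2 :: "(int \<Rightarrow> complex) \<Rightarrow> bool" where
  "ell2 c \<equiv> (\<lambda>n. (cmod (c n))\<^sup>2) summable_on UNIV"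

lemma ell2_bound:
  assumes "ell2 c" "\<And>n. cmod (d n) \<le> C * cmod (c n)"
  shows "ell2 d"
proof (rule summable_on_comparison_test)
  show "(\<lambda>n. C\<^sup>2 * (cmod (c n))\<^sup>2) summable_on UNIV"
    using assms(1) by (rule summable_on_cmult_right)
  show "(cmod (d n))\<^sup>2 \<le> C\<^sup>2 * (cmod (c n))\<^sup>2" for n
    using power_mono[OF assms(2), of n 2] by (simp add: power_mult_distrib)
qed auto

lemma norm_add_squared_le: "(norm (a + b))\<^sup>2 \<le> 2 * (norm a)\<^sup>2 + 2 * (norm (b::'a::real_normed_vector))\<^sup>2"
proof -
  have "(norm (a + b))\<^sup>2 \<le> (norm a + norm b)\<^sup>2"
    by (intro power_mono norm_triangle_ineq) auto
  also have "\<dots> \<le> 2 * (norm a)\<^sup>2 + 2 * (norm b)\<^sup>2"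
    using sum_squares_bound[of "norm a" "norm b"] by (simp add: power2_sum)
  finally show ?thesis .
qed

lemma ell2_add:
  assumes "ell2 c" "ell2 d"
  shows "ell2 (\<lambda>n. c n + d n)"
proof (rule summable_on_comparison_test)
  show "(\<lambda>n. 2 * (cmod (c n))\<^sup>2 + 2 * (cmod (d n))\<^sup>2) summable_on UNIV"
    using assms by (intro summable_on_add summable_on_cmult_right)
qed (auto intro: norm_add_squared_le)

lemma pairwise_fourier_mode:
  "pairwise (\<lambda>m n. orthogonal (fourier_mode m (c m)) (fourier_mode n (c n))) A"
  by (rule pairwiseI) (simp add: orthogonal_def inner_fourier_mode fourier_coeff_mode)

definition fourier_series :: "(int \<Rightarrow> complex) \<Rightarrow> circle_L2" where
  "fourier_series c = (\<Sum>\<^sub>\<infinity>n. fourier_mode n (c n))"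

lemma has_sum_fourier_series:
  assumes "ell2 c"
  shows "((\<lambda>n. fourier_mode n (c n)) has_sum fourier_series c) UNIV"
  unfolding fourier_series_def
proof (rule has_sum_infsum[OF summable_on_orthogonal])
  show "pairwise (\<lambda>m n. orthogonal (fourier_mode m (c m)) (fourier_mode n (c n))) UNIV"
    by (rule pairwise_fourier_mode)
  show "(\<lambda>n. (norm (fourier_mode n (c n)))\<^sup>2) summable_on UNIV"
    using assms by (simp only: norm_fourier_mode)
qed

lemma fourier_coeff_series:
  assumes "ell2 c"
  shows "fourier_coeff (fourier_series c) n = c n"
proof -
  have "((\<lambda>m. fourier_coeff (fourier_mode m (c m)) n) has_sum fourier_coeff (fourier_series c) n) UNIV"
    by (rule has_sum_bounded_linear[OF bounded_linear_fourier_coeff has_sum_fourier_series[OF assms]])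
  moreover have "((\<lambda>m. fourier_coeff (fourier_mode m (c m)) n) has_sum c n) UNIV"
    by (rule has_sum_finite_neutralI[of "{n}"]) (auto simp: fourier_coeff_mode)
  ultimately show ?thesis
    by (rule has_sum_unique)
qed

text \<open>Parseval's identity, by continuity of the scalar product in its second argument;
  \<open>f\<close> is arbitrary and may have a part outside the closed span of the modes. It turns
  orthogonality into a vanishing series.\<close>

lemma inner_fourier_series:
  assumes "ell2 c"
  shows "((\<lambda>n. Re (fourier_coeff f n * cnj (c n))) has_sum inner f (fourier_series c)) UNIV"
  using has_sum_bounded_linear[OF bounded_linear_inner_right has_sum_fourier_series[OF assms], of f]
  by (simp only: inner_fourier_mode)

lemma norm_fourier_series:
  assumes "ell2 c"
  shows "(norm (fourier_series c))\<^sup>2 = (\<Sum>\<^sub>\<infinity>n. (cmod (c n))\<^sup>2)"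
  using infsumI[OF inner_fourier_series[OF assms, of "fourier_series c"]]
  by (simp add: fourier_coeff_series[OF assms] power2_norm_eq_inner[of "fourier_series c"] cmod_power2
      flip: power2_eq_square)

lemma Re_mult_cnj: "Re (z * cnj z) = (cmod z)\<^sup>2"
  by (simp add: complex_mult_cnj cmod_power2)

text \<open>For the partial sum \<open>p\<close>, both \<open>inner f p\<close> and the squared norm
  of \<open>p\<close> equal the left-hand side, so the claim is that the squared norm of
  \<open>f - p\<close> is nonnegative.\<close>

lemma Bessel:
  assumes "finite F"
  shows "(\<Sum>n\<in>F. (cmod (fourier_coeff f n))\<^sup>2) \<le> (norm f)\<^sup>2"
proof -
  define p where "p = (\<Sum>n\<in>F. fourier_mode n (fourier_coeff f n))"
  have "inner f p = (\<Sum>n\<in>F. (cmod (fourier_coeff f n))\<^sup>2)"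
    unfolding p_def inner_sum_right inner_fourier_mode
    by (simp only: Re_mult_cnj)
  moreover have "(norm p)\<^sup>2 = (\<Sum>n\<in>F. (norm (fourier_mode n (fourier_coeff f n)))\<^sup>2)"
    unfolding p_def using assms
    by (intro norm_sum_Pythagorean pairwise_fourier_mode)
  moreover have "0 \<le> (norm (f - p))\<^sup>2"
    by simp
  ultimately show ?thesis
    by (simp add: power2_norm_eq_inner inner_diff inner_commute norm_fourier_mode)
qed

lemma ell2_fourier_coeff: "ell2 (fourier_coeff f)"
proof (rule nonneg_bdd_above_summable_on)
  show "bdd_above (sum (\<lambda>n. (cmod (fourier_coeff f n))\<^sup>2) ` {F. F \<subseteq> UNIV \<and> finite F})"
    using Bessel[of _ f] by (intro bdd_aboveI2[where M = "(norm f)\<^sup>2"]) auto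
qed auto

lemma infsum_Bessel: "(\<Sum>\<^sub>\<infinity>n. (cmod (fourier_coeff f n))\<^sup>2) \<le> (norm f)\<^sup>2"
  using Bessel[of _ f] by (intro infsum_le_finite_sums ell2_fourier_coeff) auto

lemma fourier_series_add:
  assumes "ell2 c" "ell2 d"
  shows "fourier_series (\<lambda>n. c n + d n) = fourier_series c + fourier_series d"
proof (rule has_sum_unique)
  show "((\<lambda>n. fourier_mode n (c n + d n)) has_sum fourier_series (\<lambda>n. c n + d n)) UNIV"
    by (rule has_sum_fourier_series[OF ell2_add[OF assms]])
  show "((\<lambda>n. fourier_mode n (c n + d n)) has_sum (fourier_series c + fourier_series d)) UNIV"
    using has_sum_add[OF has_sum_fourier_series[OF assms(1)] has_sum_fourier_series[OF assms(2)]]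
    by (simp add: linear_add[OF bounded_linear.linear[OF bounded_linear_fourier_mode]])
qed

lemma fourier_series_scaleR:
  assumes "ell2 c"
  shows "fourier_series (\<lambda>n. r *\<^sub>R c n) = r *\<^sub>R fourier_series c"
proof (rule has_sum_unique)
  show "((\<lambda>n. fourier_mode n (r *\<^sub>R c n)) has_sum fourier_series (\<lambda>n. r *\<^sub>R c n)) UNIV"
    by (rule has_sum_fourier_series[OF ell2_bound[OF assms, where C = "\<bar>r\<bar>"]]) simp
  show "((\<lambda>n. fourier_mode n (r *\<^sub>R c n)) has_sum (r *\<^sub>R fourier_series c)) UNIV"
    using has_sum_bounded_linear[OF bounded_linear_scaleR_right has_sum_fourier_series[OF assms], of r]
    by (simp add: linear_cmul[OF bounded_linear.linear[OF bounded_linear_fourier_mode]])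
qed

lemma fourier_coeff_add: "fourier_coeff (f + g) n = fourier_coeff f n + fourier_coeff g n"
  and fourier_coeff_diff: "fourier_coeff (f - g) n = fourier_coeff f n - fourier_coeff g n"
  and fourier_coeff_scaleR: "fourier_coeff (r *\<^sub>R f) n = r *\<^sub>R fourier_coeff f n"
  and fourier_coeff_zero: "fourier_coeff 0 n = 0"
proof -
  note lin = bounded_linear.linear[OF bounded_linear_fourier_coeff, of n]
  show "fourier_coeff (f + g) n = fourier_coeff f n + fourier_coeff g n"
    using linear_add[OF lin] .
  show "fourier_coeff (f - g) n = fourier_coeff f n - fourier_coeff g n"
    using linear_diff[OF lin] .
  show "fourier_coeff (r *\<^sub>R f) n = r *\<^sub>R fourier_coeff f n"
    using linear_cmul[OF lin] .
  show "fourier_coeff 0 n = 0"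
    using linear_0[OF lin] .
qed

lemma fourier_series_zero: "fourier_series (\<lambda>_. 0) = 0"
  unfolding fourier_series_def
  by (simp add: linear_0[OF bounded_linear.linear[OF bounded_linear_fourier_mode]])

section \<open>The semigroup and the Riesz projector as Fourier multipliers\<close>

lemma half_heat_semigroup_eq:
  "half_heat_semigroup t f =
    fourier_series (\<lambda>n. fourier_coeff f n * of_real (exp (- (real_of_int \<bar>n\<bar> * t))))"
  by (simp add: half_heat_semigroup_def fourier_series_def fourier_mode_def)

lemma riesz_projector_eq:
  "riesz_projector f = fourier_series (\<lambda>n. if n \<ge> 0 then fourier_coeff f n else 0)"
  unfolding riesz_projector_def fourier_series_def fourier_mode_def
  by (rule infsum_cong_neutral) (auto simp: L2_class_zero)

lemma fourier_coeff_riesz_projector: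
  "fourier_coeff (riesz_projector f) n = (if n \<ge> 0 then fourier_coeff f n else 0)"
  unfolding riesz_projector_eq
  by (rule fourier_coeff_series[OF ell2_bound[OF ell2_fourier_coeff[of f], of _ 1]]) auto

text \<open>This is the orthogonal projection onto the closed span of the modes. Bessel's inequality
  makes it a contraction, so it commutes with Bochner integrals.\<close>

lemma bounded_linear_fourier_projection: "bounded_linear (\<lambda>f. fourier_series (fourier_coeff f))"
proof (rule bounded_linear_intro)
  fix f g r
  show "fourier_series (fourier_coeff (f + g)) = fourier_series (fourier_coeff f) + fourier_series (fourier_coeff g)"
    by (simp add: fourier_coeff_add[abs_def] fourier_series_add ell2_fourier_coeff)
  show "fourier_series (fourier_coeff (r *\<^sub>R f)) = r *\<^sub>R fourier_series (fourier_coeff f)"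
    by (simp only: fourier_coeff_scaleR[abs_def] fourier_series_scaleR[OF ell2_fourier_coeff])
  have "(norm (fourier_series (fourier_coeff f)))\<^sup>2 \<le> (norm f)\<^sup>2"
    by (simp add: norm_fourier_series ell2_fourier_coeff infsum_Bessel)
  then show "norm (fourier_series (fourier_coeff f)) \<le> norm f * 1"
    by simp
qed

text \<open>Infinite sums converge along the net of finite sets, but measurability passes only to
  limits of sequences; symmetric intervals give a cofinal sequence.\<close>

lemma filterlim_symmetric_intervals:
  "filterlim (\<lambda>N. {- int N..int N}) (finite_subsets_at_top UNIV) sequentially"
  unfolding filterlim_finite_subsets_at_top
proof (intro allI impI)
  fix X :: "int set" assume X: "finite X \<and> X \<subseteq> UNIV"
  show "\<forall>\<^sub>F N in sequentially. finite {- int N..int N} \<and> X \<subseteq> {- int N..int N} \<and> {- int N..int N} \<subseteq> UNIV"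
    using eventually_ge_at_top[of "\<Sum>x\<in>X. nat \<bar>x\<bar>"]
  proof eventually_elim
    case (elim N)
    have "nat \<bar>x\<bar> \<le> N" if "x \<in> X" for x
      using member_le_sum[of x X "\<lambda>x. nat \<bar>x\<bar>"] X that elim by simp
    then show ?case by force
  qed
qed

text \<open>Termwise integration of the Duhamel integral. Partial sums are continuous in
  \<open>s\<close>, which gives measurability; the majorant \<open>g\<close>, uniform in
  \<open>s\<close>, bounds the norm and gives integrability; the coefficients of the integral follow
  by taking continuous functionals inside.\<close>

lemma fourier_series_integral:
  fixes a :: "real \<Rightarrow> int \<Rightarrow> complex"
  assumes T: "0 \<le> T" and cont: "\<And>n. continuous_on {0..T} (\<lambda>s. a s n)"
    and bound: "\<And>s n. s \<in> {0..T} \<Longrightarrow> (cmod (a s n))\<^sup>2 \<le> g n" and g: "g summable_on UNIV"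
  shows "(LINT s:{0..T}|lborel. fourier_series (a s)) = fourier_series (\<lambda>n. LINT s:{0..T}|lborel. a s n)"
proof -
  define F where "F s = indicator {0..T} s *\<^sub>R fourier_series (a s)" for s
  have ell2: "ell2 (a s)" if "s \<in> {0..T}" for s
    by (rule summable_on_comparison_test[OF g]) (auto intro: bound that)
  have meas: "F \<in> borel_measurable lborel"
  proof (rule borel_measurable_LIMSEQ_metric)
    show "(\<lambda>s. \<Sum>n\<in>{- int N..int N}. indicator {0..T} s *\<^sub>R fourier_mode n (a s n)) \<in> borel_measurable lborel" for N
    proof (rule borel_measurable_sum)
      fix n
      have "continuous_on {0..T} (\<lambda>s. fourier_mode n (a s n))"
        by (rule bounded_linear.continuous_on[OF bounded_linear_fourier_mode cont])
      then show "(\<lambda>s. indicator {0..T} s *\<^sub>R fourier_mode n (a s n)) \<in> borel_measurable lborel"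
        using borel_measurable_continuous_on_indicator[of "{0..T}"] by simp
    qed
    show "(\<lambda>N. \<Sum>n\<in>{- int N..int N}. indicator {0..T} s *\<^sub>R fourier_mode n (a s n)) \<longlonglongrightarrow> F s" for s
    proof (cases "s \<in> {0..T}")
      case True
      then show ?thesis
        using filterlim_compose[OF has_sum_fourier_series[OF ell2[OF True], unfolded has_sum_def]
            filterlim_symmetric_intervals] by (simp add: F_def)
    qed (simp add: F_def)
  qed
  have bnd: "norm (F s) \<le> sqrt (infsum g UNIV)" for s
  proof (cases "s \<in> {0..T}")
    case True
    have "(norm (F s))\<^sup>2 = (\<Sum>\<^sub>\<infinity>n. (cmod (a s n))\<^sup>2)"
      using True by (simp add: F_def norm_fourier_series[OF ell2])
    also have "\<dots> \<le> infsum g UNIV"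
      using True by (intro infsum_mono ell2 g bound)
    finally show ?thesis
      by (rule real_le_rsqrt)
  next
    case False
    \<comment> \<open>\<open>g\<close> is nonnegative because \<open>bound\<close> applies at time
      0, which belongs to the interval.\<close>
    have "0 \<le> infsum g UNIV"
      using order_trans[OF zero_le_power2 bound[of 0]] T by (auto intro!: infsum_nonneg)
    then show ?thesis
      using False by (auto simp: F_def)
  qed
  have int: "integrable lborel F"
  proof (rule integrableI_bounded_set[where A = "{0..T}" and B = "sqrt (infsum g UNIV)"])
    show "AE s in lborel. s \<in> {0..T} \<longrightarrow> norm (F s) \<le> sqrt (infsum g UNIV)"
      using bnd by simp
    show "AE s in lborel. s \<notin> {0..T} \<longrightarrow> F s = 0"
      by (simp add: F_def)
  qed (use meas T in auto)
  have coeff: "fourier_coeff (integral\<^sup>L lborel F) n = (LINT s:{0..T}|lborel. a s n)" for n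
  proof -
    have "fourier_coeff (integral\<^sup>L lborel F) n = (\<integral>s. fourier_coeff (F s) n \<partial>lborel)"
      by (rule integral_bounded_linear[OF bounded_linear_fourier_coeff int, symmetric])
    also have "\<dots> = (LINT s:{0..T}|lborel. a s n)"
      unfolding set_lebesgue_integral_def
      by (intro Bochner_Integration.integral_cong)
        (auto simp: F_def fourier_coeff_scaleR fourier_coeff_zero indicator_def fourier_coeff_series ell2)
    finally show ?thesis .
  qed
  text \<open>The projection onto the closed span of the modes fixes the integrand, hence the integral;
    completeness of the modes is not needed.\<close>
  have "fourier_series (fourier_coeff (integral\<^sup>L lborel F)) = (\<integral>s. fourier_series (fourier_coeff (F s)) \<partial>lborel)"
    by (rule integral_bounded_linear[OF bounded_linear_fourier_projection int, symmetric])
  also have "(\<lambda>s. fourier_series (fourier_coeff (F s))) = F"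
  proof
    fix s
    show "fourier_series (fourier_coeff (F s)) = F s"
    proof (cases "s \<in> {0..T}")
      case True
      then have "fourier_coeff (F s) = a s"
        by (auto simp: F_def fourier_coeff_series ell2)
      then show ?thesis
        using True by (simp add: F_def)
    qed (simp add: F_def fourier_coeff_zero[abs_def] fourier_series_zero)
  qed
  finally show ?thesis
    unfolding coeff[abs_def] by (simp only: F_def[abs_def] set_lebesgue_integral_def)
qed

section \<open>Null-controllable states\<close>

text \<open>Complex linearity is stated on representatives, since complex multiples are not an
  operation of \<open>circle_L2\<close>.\<close>

lemma fourier_coeff_lincomb:
  assumes "square_integrable circle v" "square_integrable circle w"
  shows "fourier_coeff (L2_class (\<lambda>z. a * v z + b * w z)) n =
    a * fourier_coeff (L2_class v) n + b * fourier_coeff (L2_class w) n"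
proof -
  have int: "integrable circle (\<lambda>z. f z * z powi (- n))" if "square_integrable circle f" for f
    using square_integrable_mult[OF that square_integrable_powi[of 1]] by simp
  have "fourier_coeff (L2_class (\<lambda>z. a * v z + b * w z)) n =
      (\<integral>z. a * (v z * z powi (- n)) + b * (w z * z powi (- n)) \<partial>circle)"
    using assms by (subst fourier_coeff_L2_class)
      (auto intro!: square_integrable_add square_integrable_cmult simp: algebra_simps)
  also have "\<dots> = a * (\<integral>z. v z * z powi (- n) \<partial>circle) + b * (\<integral>z. w z * z powi (- n) \<partial>circle)"
    using int[OF assms(1)] int[OF assms(2)] by (subst Bochner_Integration.integral_add) auto
  finally show ?thesis
    using assms by (simp add: fourier_coeff_L2_class)
qed

text \<open>Since - \<i> * \<i> = 1, the integrand is the derivative in \<open>s\<close> of (1 - s /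
  T) exp (- n (T - s)) c, mode n of the prescribed trajectory propagated up to time T. This vanishes
  at s = T, so only minus its value at s = 0 remains.\<close>

lemma mode_integral:
  assumes "T > 0"
  shows "(LINT s:{0..T}|lborel. (of_real (- 1 / T) * c + - \<i> * of_real (1 - s / T) * (\<i> * of_int n * c))
      * of_real (exp (- (real_of_int n * (T - s))))) = - (of_real (exp (- (real_of_int n * T))) * c)"
proof -
  \<comment> \<open>The primitive is taken as a function of a complex variable so that its
    derivative along the reals comes from a complex derivative.\<close>
  define G where "G z = (1 - z / of_real T) * exp (- (of_int n * (of_real T - z))) * c" for z :: complex
  have "(\<integral>s. indicator {0..T} s *\<^sub>R ((of_real (- 1 / T) * c + - \<i> * of_real (1 - s / T) * (\<i> * of_int n * c))
      * of_real (exp (- (real_of_int n * (T - s))))) \<partial>lborel) = G (of_real T) - G (of_real 0)"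
  proof (rule integral_FTC_atLeastAtMost)
    fix s :: real
    show "((\<lambda>s. G (of_real s)) has_vector_derivative
        ((of_real (- 1 / T) * c + - \<i> * of_real (1 - s / T) * (\<i> * of_int n * c))
      * of_real (exp (- (real_of_int n * (T - s)))))) (at s within {0..T})"
      unfolding G_def
      by (rule has_vector_derivative_real_field)
        (use assms in \<open>auto intro!: derivative_eq_intros simp: exp_of_real[symmetric] field_simps\<close>)
  qed (use assms in \<open>auto intro!: continuous_intros\<close>)
  also have "\<dots> = - (of_real (exp (- (real_of_int n * T))) * c)"
    using assms by (simp add: G_def flip: exp_of_real)
  finally show ?thesis
    by (simp add: set_lebesgue_integral_def)
qed

text \<open>\<open>w\<close> acts as the derivative of \<open>v\<close> through its Fourier
  coefficients. For n >= 0 the symbol of |D| is n = - \<i> (\<i> n), so after projection the term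
  |D| v is a multiple of \<open>w\<close>, which is still supported in \<omega>. Boundedness on a
  set of finite measure makes the control square integrable.\<close>

lemma riesz_projector_null_controllable:
  assumes \<omega>: "\<omega> \<in> sets borel" and T: "T > 0"
    and [measurable]: "v \<in> borel_measurable borel" "w \<in> borel_measurable borel"
    and bound: "\<And>z. cmod (v z) \<le> B" "\<And>z. cmod (w z) \<le> B"
    and supp: "\<And>z. z \<notin> \<omega> \<Longrightarrow> v z = 0" "\<And>z. z \<notin> \<omega> \<Longrightarrow> w z = 0"
    and deriv: "\<And>n. fourier_coeff (L2_class w) n = \<i> * of_int n * fourier_coeff (L2_class v) n"
  shows "riesz_projector (L2_class v) \<in> null_controllable \<omega> T"
proof -
  define u where "u = (\<lambda>(s, z). of_real (- 1 / T) * v z + - \<i> * of_real (1 - s / T) * w z)"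
  have sq: "square_integrable circle v" "square_integrable circle w"
    using bound by (auto intro!: square_integrable_AE_bounded AE_I2)
  have B: "B \<ge> 0"
    using order_trans[OF norm_ge_zero bound(1)] .
  have theta_le: "\<bar>1 - s / T\<bar> \<le> 1" if "s \<in> {0..T}" for s
    using that T by (auto simp: abs_le_iff field_simps)
  have u_sq: "square_integrable (restrict_space (lborel \<Otimes>\<^sub>M circle) ({0..T} \<times> \<omega>)) u"
    unfolding square_integrable_def
  proof
    have set: "{0..T} \<times> \<omega> \<in> sets (lborel \<Otimes>\<^sub>M circle)"
      using \<omega> by simp
    show m: "u \<in> borel_measurable (restrict_space (lborel \<Otimes>\<^sub>M circle) ({0..T} \<times> \<omega>))"
      unfolding u_def by (rule measurable_restrict_space1) measurable
    have "emeasure (lborel \<Otimes>\<^sub>M circle) ({0..T} \<times> \<omega>) = ennreal T * emeasure circle \<omega>"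
      using \<omega> T by (subst circle.emeasure_pair_measure_Times) auto
    also have "\<dots> < \<infinity>"
      using circle.emeasure_finite[of \<omega>] by (auto simp: ennreal_mult_eq_top_iff less_top[symmetric])
    finally have fin: "finite_measure (restrict_space (lborel \<Otimes>\<^sub>M circle) ({0..T} \<times> \<omega>))"
      using set by (intro finite_measureI) (auto simp: emeasure_restrict_space space_restrict_space)
    have le: "cmod (u x) \<le> B / T + B" if "x \<in> {0..T} \<times> \<omega>" for x
    proof -
      obtain s z where x: "x = (s, z)" "0 \<le> s" "s \<le> T"
        using \<open>x \<in> {0..T} \<times> \<omega>\<close> by (cases x) auto
      have "cmod (u x) \<le> cmod (of_real (- 1 / T) * v z) + cmod (- \<i> * of_real (1 - s / T) * w z)"
        unfolding u_def x by (simp only: prod.case) (rule norm_triangle_ineq)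
      also have "cmod (of_real (- 1 / T) * v z) \<le> B / T"
        using bound(1)[of z] T by (simp add: norm_mult norm_divide divide_right_mono)
      also have "cmod (- \<i> * of_real (1 - s / T) * w z) = \<bar>1 - s / T\<bar> * cmod (w z)"
        by (simp only: norm_mult norm_minus_cancel norm_ii norm_of_real mult_1)
      also have "\<bar>1 - s / T\<bar> * cmod (w z) \<le> 1 * B"
        using bound(2)[of z] theta_le[of s] x by (intro mult_mono) auto
      finally show ?thesis by simp
    qed
    show "integrable (restrict_space (lborel \<Otimes>\<^sub>M circle) ({0..T} \<times> \<omega>)) (\<lambda>x. (cmod (u x))\<^sup>2)"
      using le m by (intro finite_measure.integrable_const_bound[OF fin, where B = "(B / T + B)\<^sup>2"] AE_I2)
        (auto simp: space_restrict_space intro!: power_mono)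
  qed
  \<comment> \<open>Coefficient \<open>n\<close> of the Duhamel integrand; the case split is the
    projector, and it allows |n| to be written as n in the exponent.\<close>
  define a where "a s n = (if n \<ge> 0 then (of_real (- 1 / T) * fourier_coeff (L2_class v) n
      + - \<i> * of_real (1 - s / T) * fourier_coeff (L2_class w) n)
      * of_real (exp (- (real_of_int n * (T - s)))) else 0)" for s :: real and n :: int
  have series: "half_heat_semigroup (T - s) (riesz_projector (extend_by_zero \<omega> (\<lambda>z. u (s, z)))) = fourier_series (a s)" for s
  proof -
    have "(\<lambda>z. if z \<in> \<omega> then u (s, z) else 0) =
        (\<lambda>z. of_real (- 1 / T) * v z + (- \<i> * of_real (1 - s / T)) * w z)"
      using supp by (auto simp: u_def fun_eq_iff)
    then have "fourier_coeff (extend_by_zero \<omega> (\<lambda>z. u (s, z))) n =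
      of_real (- 1 / T) * fourier_coeff (L2_class v) n
        + (- \<i> * of_real (1 - s / T)) * fourier_coeff (L2_class w) n" for n
      unfolding extend_by_zero_def by (simp only: fourier_coeff_lincomb[OF sq])
    then show ?thesis
      unfolding half_heat_semigroup_eq fourier_coeff_riesz_projector a_def
      by (intro arg_cong[of _ _ fourier_series] ext) auto
  qed
  have integral: "(LINT s:{0..T}|lborel. a s n) =
      (if n \<ge> 0 then - (of_real (exp (- (real_of_int n * T))) * fourier_coeff (L2_class v) n) else 0)" for n
    unfolding a_def deriv using mode_integral[OF T, of _ n] by simp
  have e_le: "exp (- (real_of_int n * (T - s))) \<le> 1" if "n \<ge> 0" "s \<in> {0..T}" for n s
    using that by simp
  have "(LINT s:{0..T}|lborel. fourier_series (a s)) = fourier_series (\<lambda>n. LINT s:{0..T}|lborel. a s n)"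
  proof (rule fourier_series_integral)
    show "continuous_on {0..T} (\<lambda>s. a s n)" for n
      unfolding a_def by (cases "n \<ge> 0") (auto intro!: continuous_intros simp: T[THEN less_imp_neq, symmetric])
    \<comment> \<open>The majorant uses that the exponential and |1 - s / T| are at most 1, and then
      |p + q|^2 <= 2 |p|^2 + 2 |q|^2.\<close>
    show "(\<lambda>n. 2 * ((1 / T)\<^sup>2 * (cmod (fourier_coeff (L2_class v) n))\<^sup>2) + 2 * (cmod (fourier_coeff (L2_class w) n))\<^sup>2)
        summable_on UNIV"
      by (intro summable_on_add summable_on_cmult_right ell2_fourier_coeff)
    fix s n assume s: "s \<in> {0..T}"
    show "(cmod (a s n))\<^sup>2 \<le> 2 * ((1 / T)\<^sup>2 * (cmod (fourier_coeff (L2_class v) n))\<^sup>2)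
      + 2 * (cmod (fourier_coeff (L2_class w) n))\<^sup>2"
    proof (cases "n \<ge> 0")
      case True
      let ?p = "of_real (- 1 / T) * fourier_coeff (L2_class v) n"
      let ?q = "- \<i> * of_real (1 - s / T) * fourier_coeff (L2_class w) n"
      have "cmod (a s n) = cmod (?p + ?q) * exp (- (real_of_int n * (T - s)))"
        unfolding a_def using True by (simp add: norm_mult del: exp_of_real)
      also have "\<dots> \<le> cmod (?p + ?q)"
        using e_le[OF True s] by (intro mult_left_le) auto
      finally have "(cmod (a s n))\<^sup>2 \<le> (cmod (?p + ?q))\<^sup>2"
        by (intro power_mono) auto
      also have "\<dots> \<le> 2 * (cmod ?p)\<^sup>2 + 2 * (cmod ?q)\<^sup>2"
        by (rule norm_add_squared_le)
      also have "(cmod ?p)\<^sup>2 = (1 / T)\<^sup>2 * (cmod (fourier_coeff (L2_class v) n))\<^sup>2"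
        using T by (simp add: norm_mult norm_divide power_mult_distrib power_divide)
      also have "cmod ?q = \<bar>1 - s / T\<bar> * cmod (fourier_coeff (L2_class w) n)"
        by (simp only: norm_mult norm_minus_cancel norm_ii norm_of_real mult_1)
      also have "(\<bar>1 - s / T\<bar> * cmod (fourier_coeff (L2_class w) n))\<^sup>2 \<le> (1 * cmod (fourier_coeff (L2_class w) n))\<^sup>2"
        using theta_le[OF s] by (intro power_mono mult_right_mono) auto
      finally show ?thesis by simp
    qed (auto simp: a_def)
  qed (use T in simp)
  then have "mild_solution \<omega> (riesz_projector (L2_class v)) u T =
    fourier_series (\<lambda>n. if n \<ge> 0 then of_real (exp (- (real_of_int n * T))) * fourier_coeff (L2_class v) n else 0)
    + fourier_series (\<lambda>n. if n \<ge> 0 then - (of_real (exp (- (real_of_int n * T))) * fourier_coeff (L2_class v) n) else 0)"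
    unfolding mild_solution_def series integral
    by (simp only:) (auto intro!: arg_cong[of _ _ fourier_series] simp: half_heat_semigroup_eq fourier_coeff_riesz_projector)
  also have "\<dots> = fourier_series (\<lambda>_. 0)"
  proof (subst fourier_series_add[symmetric])
    have "cmod (exp (- complex_of_real (real_of_int n * T))) \<le> 1" if "n \<ge> 0" for n
      using that T by simp
    then show "ell2 (\<lambda>n. if n \<ge> 0 then of_real (exp (- (real_of_int n * T))) * fourier_coeff (L2_class v) n else 0)"
      "ell2 (\<lambda>n. if n \<ge> 0 then - (of_real (exp (- (real_of_int n * T))) * fourier_coeff (L2_class v) n) else 0)"
      using T by (auto intro!: ell2_bound[OF ell2_fourier_coeff[of "L2_class v"], of _ 1] mult_left_le_one_le simp: norm_mult)
  qed (auto intro!: arg_cong[of _ _ fourier_series])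
  finally have "mild_solution \<omega> (riesz_projector (L2_class v)) u T = 0"
    by (simp add: fourier_series_zero)
  then show ?thesis
    unfolding null_controllable_def hardy_space_def using u_sq by blast
qed

section \<open>Power series and orthogonality\<close>

lemma norm_summable_power_series:
  fixes c :: "nat \<Rightarrow> complex"
  assumes "summable (\<lambda>n. cmod (c n))" "cmod z \<le> 1"
  shows "summable (\<lambda>n. c n * z ^ n)"
  by (rule summable_comparison_test'[OF assms(1), of 0])
    (use assms(2) in \<open>auto simp: norm_mult norm_power intro!: mult_left_le power_le_one\<close>)

lemma continuous_on_power_series:
  fixes c :: "nat \<Rightarrow> complex"
  assumes "summable (\<lambda>n. cmod (c n))"
  shows "continuous_on (cball 0 1) (\<lambda>z. \<Sum>n. c n * z ^ n)"
proof (rule uniform_limit_theorem)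
  show "uniform_limit (cball 0 1) (\<lambda>N z. \<Sum>n<N. c n * z ^ n) (\<lambda>z. \<Sum>n. c n * z ^ n) sequentially"
    by (rule Weierstrass_m_test[OF _ assms])
      (auto simp: norm_mult norm_power intro!: mult_left_le power_le_one)
qed (auto intro!: always_eventually continuous_intros)

lemma holomorphic_on_power_series:
  fixes c :: "nat \<Rightarrow> complex"
  assumes "summable (\<lambda>n. cmod (c n))"
  shows "(\<lambda>z. \<Sum>n. c n * z ^ n) holomorphic_on ball 0 1"
  by (rule power_series_holomorphic[where a = c])
    (auto intro!: summable_sums norm_summable_power_series[OF assms])

text \<open>If the rotation step 2 pi / N is shorter than the arc, successive rotations of a point
  cannot jump over the arc.\<close>

lemma rotate_into_arc:
  assumes "\<alpha> < \<beta>"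
  obtains N :: nat where "N > 0"
    "\<And>\<theta>. \<exists>j<N. \<exists>y. \<alpha> < y \<and> y < \<beta> \<and> cis (2 * pi * real j / real N) * cis \<theta> = cis y"
proof -
  obtain N :: nat where N: "2 * pi / (\<beta> - \<alpha>) < real N"
    using reals_Archimedean2 by blast
  have "0 < 2 * pi / (\<beta> - \<alpha>)"
    using assms by simp
  then have N0: "N > 0"
    using N by linarith
  have N': "2 * pi / real N < \<beta> - \<alpha>"
    using N assms N0 by (simp add: field_simps)
  show thesis
  proof (rule that[OF N0])
    fix \<theta> :: real
    \<comment> \<open>\<open>x\<close> is the real number of steps that leads exactly to \<alpha>;
      \<open>i\<close> is the first integer beyond it, so the overshoot is at most one step, less
      than \<beta> - \<alpha>.\<close>
    define x where "x = (\<alpha> - \<theta>) * real N / (2 * pi)"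
    define i where "i = \<lfloor>x\<rfloor> + 1"
    \<comment> \<open>Reduction modulo \<open>N\<close> changes the angle by a multiple of 2 pi and
      bounds the number of rotations independently of \<theta>.\<close>
    define j where "j = nat (i mod int N)"
    define q where "q = i div int N"
    have i: "x < of_int i" "of_int i \<le> x + 1"
      unfolding i_def by linarith+
    have j: "j < N" and ij: "i = int N * q + int j"
      using N0 by (auto simp: j_def q_def nat_less_iff)
    have "of_int i = real N * of_int q + real j"
      using ij by (metis of_int_add of_int_mult of_int_of_nat_eq)
    then have "2 * pi * of_int i / real N = 2 * pi * real j / real N + 2 * pi * of_int q"
      using N0 by (simp add: field_simps)
    then have "cis (\<theta> + 2 * pi * of_int i / real N) = cis (2 * pi * real j / real N) * cis \<theta> * cis (2 * pi * of_int q)"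
      by (simp add: cis_mult algebra_simps)
    also have "cis (2 * pi * of_int q) = 1"
      by (rule cis_multiple_2pi) auto
    finally have "cis (2 * pi * real j / real N) * cis \<theta> = cis (\<theta> + 2 * pi * of_int i / real N)"
      by simp
    moreover have "\<alpha> < \<theta> + 2 * pi * of_int i / real N"
      using i(1) N0 by (simp add: x_def field_simps)
    moreover have "\<theta> + 2 * pi * of_int i / real N \<le> \<alpha> + 2 * pi / real N"
    proof -
      have "of_int i * (2 * pi / real N) \<le> (x + 1) * (2 * pi / real N)"
        by (rule mult_right_mono[OF i(2)]) simp
      also have "\<dots> = \<alpha> - \<theta> + 2 * pi / real N"
        using N0 by (simp add: x_def add_divide_distrib distrib_right)
      finally show ?thesis by (simp add: mult.commute)
    qed
    ultimately show "\<exists>j<N. \<exists>y. \<alpha> < y \<and> y < \<beta> \<and> cis (2 * pi * real j / real N) * cis \<theta> = cis y"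
      using j N' by (intro exI[of _ j] conjI exI[of _ "\<theta> + 2 * pi * of_int i / real N"]) auto
  qed
qed

text \<open>Finitely many rotations of the arc cover the circle, so after division by a power of \<open>z\<close>
  the product of the rotated functions vanishes on the circle but not at the origin.\<close>

lemma power_series_zero_on_arc:
  fixes b :: "nat \<Rightarrow> complex"
  assumes b: "summable (\<lambda>n. cmod (b n))" and "\<alpha> < \<beta>"
    and zero: "\<And>y. \<alpha> < y \<Longrightarrow> y < \<beta> \<Longrightarrow> (\<Sum>n. b n * cis y ^ n) = 0"
  shows "b n = 0"
proof (rule ccontr)
  assume "b n \<noteq> 0"
  \<comment> \<open>Removing the first \<open>m\<close> coefficients gives a series \<open>G\<close>
    with the nonzero value \<open>b m\<close> at 0; it keeps the zeros on the arc, where z ^ m has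
    modulus 1.\<close>
  define m where "m = (LEAST m. b m \<noteq> 0)"
  have m: "b m \<noteq> 0"
    unfolding m_def using \<open>b n \<noteq> 0\<close> by (rule LeastI)
  have less: "b i = 0" if "i < m" for i
    using not_less_Least[of i "\<lambda>m. b m \<noteq> 0"] that unfolding m_def by blast
  define c where "c n = b (n + m)" for n
  have c: "summable (\<lambda>n. cmod (c n))"
    unfolding c_def using b by (rule summable_ignore_initial_segment)
  define G where "G z = (\<Sum>n. c n * z ^ n)" for z
  have G0: "G 0 = b m"
    unfolding G_def by (simp add: c_def)
  have factor: "(\<Sum>n. b n * z ^ n) = z ^ m * G z" if "cmod z \<le> 1" for z
  proof -
    have "(\<Sum>n. b n * z ^ n) = (\<Sum>n. b (n + m) * z ^ (n + m)) + (\<Sum>n<m. b n * z ^ n)"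
      by (rule suminf_split_initial_segment[OF norm_summable_power_series[OF b that]])
    also have "(\<Sum>n<m. b n * z ^ n) = 0"
      using less by simp
    also have "(\<lambda>n. b (n + m) * z ^ (n + m)) = (\<lambda>n. z ^ m * (c n * z ^ n))"
      by (simp add: c_def power_add fun_eq_iff)
    finally show ?thesis
      unfolding G_def by (simp add: suminf_mult[OF norm_summable_power_series[OF c that]])
  qed
  have G_arc: "G (cis y) = 0" if "\<alpha> < y" "y < \<beta>" for y
    using factor[of "cis y"] zero[OF that] by simp
  obtain N :: nat where N: "N > 0"
    "\<And>\<theta>. \<exists>j<N. \<exists>y. \<alpha> < y \<and> y < \<beta> \<and> cis (2 * pi * real j / real N) * cis \<theta> = cis y"
    using rotate_into_arc[OF \<open>\<alpha> < \<beta>\<close>] by metis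
  define P where "P z = (\<Prod>j<N. G (cis (2 * pi * real j / real N) * z))" for z
  \<comment> \<open>Every factor equals \<open>G 0\<close> at the origin, so \<open>P 0\<close> is
    \<open>b m ^ N\<close>, which is nonzero; the maximum modulus principle with zero boundary
    values contradicts this.\<close>
  have "cmod (P 0) \<le> 0"
  proof (rule maximum_modulus_frontier[where S = "ball 0 1" and f = P and \<xi> = 0])
    have "(\<lambda>z. G (cis (2 * pi * real j / real N) * z)) holomorphic_on ball 0 1" for j
      by (rule holomorphic_on_compose_gen[OF _ holomorphic_on_power_series[OF c, folded G_def], unfolded o_def])
        (auto intro!: holomorphic_intros simp: norm_mult)
    then show "P holomorphic_on interior (ball 0 1)"
      unfolding P_def by (auto intro!: holomorphic_on_prod)
    have "continuous_on (cball 0 1) (\<lambda>z. G (cis (2 * pi * real j / real N) * z))" for j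
      by (rule continuous_on_compose2[OF continuous_on_power_series[OF c, folded G_def]])
        (auto intro!: continuous_intros simp: norm_mult)
    then show "continuous_on (closure (ball 0 1)) P"
      unfolding P_def by (auto intro!: continuous_on_prod)
    fix z :: complex assume "z \<in> frontier (ball 0 1)"
    then have z: "z = cis (Arg2pi z)"
      using complex_norm_eq_1_exp[of z] by (simp add: cis_conv_exp)
    obtain j y where "j < N" "\<alpha> < y" "y < \<beta>" "cis (2 * pi * real j / real N) * z = cis y"
      using N(2)[of "Arg2pi z"] z by metis
    then have "P z = 0"
      unfolding P_def by (intro prod_zero) (auto simp: G_arc intro!: bexI[of _ j])
    then show "cmod (P z) \<le> 0"
      by simp
  qed auto
  then show False
    using m by (simp add: P_def G0)
qed

text \<open>A minimizing sequence for the distance from \<open>x\<close> to \<open>S\<close> is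
  Cauchy by the parallelogram law. Its limit \<open>p\<close> lies in the closure, and minimality of
  the distance makes \<open>x - p\<close> orthogonal to \<open>S\<close>.\<close>

lemma orthogonal_decomposition:
  fixes S :: "'a::{real_inner, banach} set"
  assumes S: "subspace S"
  obtains p d where "x = p + d" "p \<in> closure S" "\<And>s. s \<in> S \<Longrightarrow> inner d s = 0"
proof -
  define \<delta> where "\<delta> = infdist x S"
  have ne: "S \<noteq> {}"
    using subspace_0[OF S] by auto
  have \<delta>0: "0 \<le> \<delta>"
    unfolding \<delta>_def by (rule infdist_nonneg)
  have "\<exists>s\<in>S. dist x s < \<delta> + 1 / real (Suc n)" for n
  proof (rule ccontr)
    assume "\<not> (\<exists>s\<in>S. dist x s < \<delta> + 1 / real (Suc n))"
    then have "\<delta> + 1 / real (Suc n) \<le> infdist x S"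
      unfolding infdist_notempty[OF ne] using ne by (intro cINF_greatest) (auto simp: not_less)
    moreover have "0 < 1 / real (Suc n)" by simp
    ultimately show False unfolding \<delta>_def by linarith
  qed
  then obtain s where s: "\<And>n. s n \<in> S" "\<And>n. dist x (s n) < \<delta> + 1 / real (Suc n)"
    by metis
  have lim: "(\<lambda>n. dist x (s n)) \<longlonglongrightarrow> \<delta>"
  proof (rule tendsto_sandwich[of "\<lambda>_. \<delta>"])
    show "(\<lambda>n. \<delta> + 1 / real (Suc n)) \<longlonglongrightarrow> \<delta>"
      using tendsto_add[OF tendsto_const[of \<delta>] LIMSEQ_Suc[OF lim_1_over_n]] by simp
    show "\<forall>\<^sub>F n in sequentially. \<delta> \<le> dist x (s n)"
      unfolding \<delta>_def by (intro always_eventually allI infdist_le s)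
    show "\<forall>\<^sub>F n in sequentially. dist x (s n) \<le> \<delta> + 1 / real (Suc n)"
      by (intro always_eventually allI less_imp_le s)
  qed (rule tendsto_const)
  have "Cauchy s"
  proof (rule metric_CauchyI)
    fix e :: real assume e: "e > 0"
    have "(\<lambda>n. (dist x (s n))\<^sup>2) \<longlonglongrightarrow> \<delta>\<^sup>2"
      by (intro tendsto_intros lim)
    \<comment> \<open>The parallelogram law bounds the squared distance of two members by 4
      (\<delta>^2 + e^2 / 4) - 4 \<delta>^2 = e^2.\<close>
    then have "\<forall>\<^sub>F n in sequentially. (dist x (s n))\<^sup>2 < \<delta>\<^sup>2 + e\<^sup>2 / 4"
      by (rule order_tendstoD) (use e in simp)
    then obtain M where M: "\<And>n. n \<ge> M \<Longrightarrow> (dist x (s n))\<^sup>2 < \<delta>\<^sup>2 + e\<^sup>2 / 4"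
      unfolding eventually_sequentially by blast
    have "dist (s m) (s n) < e" if "m \<ge> M" "n \<ge> M" for m n
    proof (rule power2_less_imp_less)
      have "(1 / 2) *\<^sub>R (s m + s n) \<in> S"
        by (intro subspace_scale[OF S] subspace_add[OF S] s)
      then have "\<delta>\<^sup>2 \<le> (dist x ((1 / 2) *\<^sub>R (s m + s n)))\<^sup>2"
        using \<delta>0 unfolding \<delta>_def by (intro power_mono infdist_le) auto
      moreover have "(dist (s m) (s n))\<^sup>2 = 2 * (dist x (s m))\<^sup>2 + 2 * (dist x (s n))\<^sup>2
          - 4 * (dist x ((1 / 2) *\<^sub>R (s m + s n)))\<^sup>2"
        unfolding dist_norm power2_norm_eq_inner
        by (simp add: inner_diff inner_add inner_commute algebra_simps)
      ultimately show "(dist (s m) (s n))\<^sup>2 < e\<^sup>2"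
        using M[OF that(1)] M[OF that(2)] by linarith
    qed (use e in simp)
    then show "\<exists>M. \<forall>m\<ge>M. \<forall>n\<ge>M. dist (s m) (s n) < e"
      by blast
  qed
  then obtain p where p: "s \<longlonglongrightarrow> p"
    by (auto simp: Cauchy_convergent_iff convergent_def)
  have pS: "p \<in> closure S"
    unfolding closure_sequential using s(1) p by blast
  have dp: "dist x p = \<delta>"
    by (rule LIMSEQ_unique[OF tendsto_dist[OF tendsto_const p] lim])
  have "inner (x - p) t = 0" if t: "t \<in> S" for t
  proof (cases "t = 0")
    case False
    \<comment> \<open>This \<open>r\<close> minimizes the distance from \<open>x\<close> to
      \<open>p + r *\<^sub>R t\<close>; moving there lowers the squared distance by (inner (x - p)
      t)^2 / (norm t)^2, which therefore must be 0.\<close>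
    define r where "r = inner (x - p) t / (norm t)\<^sup>2"
    \<comment> \<open>The comparison is made at \<open>s n\<close> and passed to the limit because
      \<open>p\<close> itself may lie outside \<open>S\<close>.\<close>
    have "\<delta> \<le> dist x (s n + r *\<^sub>R t)" for n
      unfolding \<delta>_def by (intro infdist_le subspace_add[OF S] subspace_scale[OF S] s t)
    moreover have "(\<lambda>n. dist x (s n + r *\<^sub>R t)) \<longlonglongrightarrow> dist x (p + r *\<^sub>R t)"
      by (intro tendsto_intros p)
    ultimately have "\<delta> \<le> dist x (p + r *\<^sub>R t)"
      by (intro LIMSEQ_le_const) auto
    then have "(dist x p)\<^sup>2 \<le> (dist x (p + r *\<^sub>R t))\<^sup>2"
      unfolding dp using \<delta>0 by (intro power_mono) auto
    also have "x - (p + r *\<^sub>R t) = (x - p) - r *\<^sub>R t"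
      by simp
    then have "(dist x (p + r *\<^sub>R t))\<^sup>2 = (dist x p)\<^sup>2 - 2 * r * inner (x - p) t + r\<^sup>2 * (norm t)\<^sup>2"
      unfolding dist_norm power2_norm_eq_inner
      by (simp only: inner_diff_left inner_diff_right inner_scaleR_left inner_scaleR_right)
        (simp add: inner_commute power2_eq_square algebra_simps)
    also have "\<dots> = (dist x p)\<^sup>2 - (inner (x - p) t)\<^sup>2 / (norm t)\<^sup>2"
      using False by (simp add: r_def power2_eq_square field_simps)
    finally have "(inner (x - p) t)\<^sup>2 / (norm t)\<^sup>2 \<le> 0"
      by simp
    then show ?thesis
      using False by (simp add: divide_le_0_iff)
  qed simp
  then show thesis
    using pS by (intro that[of p "x - p"]) auto
qed

section \<open>Bump functions\<close>

lemma borel_measurable_Arg2pi [measurable]: "Arg2pi \<in> borel_measurable borel"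
  by (rule borel_measurableI_greater) (simp add: open_Arg2pi2pi_gt)

lemma Arg2pi_cis: "0 \<le> x \<Longrightarrow> x < 2 * pi \<Longrightarrow> Arg2pi (cis x) = x"
  by (rule Arg2pi_unique[of 1]) (auto simp: cis_conv_exp)

lemma cis_Arg2pi: "cmod z = 1 \<Longrightarrow> cis (Arg2pi z) = z"
  by (simp add: cis_conv_exp flip: complex_norm_eq_1_exp)

text \<open>An arc is not open in the plane. Rotating its start to angle 0 describes it by
  inequalities on \<open>Arg2pi\<close> that stay away from the branch jump, because its length is
  less than 2 pi.\<close>

lemma open_strict_interval_borel:
  assumes "open_strict_interval \<omega>"
  shows "\<omega> \<in> sets borel"
proof -
  obtain a b where ab: "b - a < 2 * pi" "\<omega> = cis ` {a<..<b}"
    using assms by (auto simp: open_strict_interval_def)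
  have "\<omega> = {z. cmod z = 1 \<and> 0 < Arg2pi (z * cis (- a)) \<and> Arg2pi (z * cis (- a)) < b - a}"
  proof (intro set_eqI iffI)
    fix z assume "z \<in> \<omega>"
    then obtain x where x: "a < x" "x < b" "z = cis x"
      using ab(2) by auto
    then have "z * cis (- a) = cis (x - a)"
      by (simp add: cis_mult)
    then show "z \<in> {z. cmod z = 1 \<and> 0 < Arg2pi (z * cis (- a)) \<and> Arg2pi (z * cis (- a)) < b - a}"
      using x ab(1) by (simp add: Arg2pi_cis)
  next
    fix z assume "z \<in> {z. cmod z = 1 \<and> 0 < Arg2pi (z * cis (- a)) \<and> Arg2pi (z * cis (- a)) < b - a}"
    then have z: "cmod z = 1" "0 < Arg2pi (z * cis (- a))" "Arg2pi (z * cis (- a)) < b - a"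
      by auto
    then have "cis (Arg2pi (z * cis (- a))) = z * cis (- a)"
      by (intro cis_Arg2pi) (simp add: norm_mult)
    then have "cis (a + Arg2pi (z * cis (- a))) = cis a * (z * cis (- a))"
      by (simp only: cis_mult[symmetric])
    also have "\<dots> = z * (cis a * cis (- a))"
      by (simp only: mult_ac)
    also have "cis a * cis (- a) = 1"
      by (simp add: cis_mult)
    finally have "z = cis (a + Arg2pi (z * cis (- a)))"
      by simp
    then show "z \<in> \<omega>"
      unfolding ab(2) using z by (intro image_eqI[of _ _ "a + Arg2pi (z * cis (- a))"]) auto
  qed
  also have "\<dots> \<in> sets borel"
    by measurable
  finally show ?thesis .
qed

text \<open>The closed subarc avoids the jump of \<open>Arg2pi\<close>, so bumps supported in it can
  be written in terms of the angle without wrapping around. It is the middle third of a piece of the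
  arc within one period.\<close>

lemma open_strict_interval_contains_arc:
  assumes "open_strict_interval \<omega>"
  obtains \<alpha> \<beta> where "0 \<le> \<alpha>" "\<alpha> < \<beta>" "\<beta> < 2 * pi" "cis ` {\<alpha>..\<beta>} \<subseteq> \<omega>"
proof -
  obtain a b where ab: "a < b" "\<omega> = cis ` {a<..<b}"
    using assms by (auto simp: open_strict_interval_def)
  define q where "q = \<lfloor>a / (2 * pi)\<rfloor>"
  define a' where "a' = a - 2 * pi * of_int q"
  \<comment> \<open>Truncation at 2 pi discards what lies beyond angle 0 if the arc crosses
    it.\<close>
  define b' where "b' = min (b - 2 * pi * of_int q) (2 * pi)"
  have "of_int q \<le> a / (2 * pi)" "a / (2 * pi) < of_int q + 1"
    unfolding q_def by linarith+
  then have a': "0 \<le> a'" "a' < 2 * pi"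
    by (auto simp: a'_def field_simps)
  have b': "a' < b'"
    using a' ab(1) by (auto simp: a'_def b'_def)
  define \<alpha> where "\<alpha> = a' + (b' - a') / 3"
  define \<beta> where "\<beta> = a' + 2 * (b' - a') / 3"
  have lt: "a' < \<alpha>" "\<alpha> < \<beta>" "\<beta> < b'"
    using b' by (auto simp: \<alpha>_def \<beta>_def field_simps)
  have "cis x \<in> \<omega>" if "\<alpha> \<le> x" "x \<le> \<beta>" for x
  proof -
    have "cis x = cis (x + 2 * pi * of_int q)"
      using cis_multiple_2pi[of "of_int q"] by (simp flip: cis_mult)
    moreover have "x + 2 * pi * of_int q \<in> {a<..<b}"
      using that lt by (auto simp: a'_def b'_def)
    ultimately show ?thesis
      unfolding ab(2) by (rule image_eqI)
  qed
  moreover have "\<beta> < 2 * pi"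
    using lt(3) by (simp add: b'_def)
  ultimately show thesis
    using a' lt by (intro that[of \<alpha> \<beta>]) auto
qed

text \<open>A polynomial cut off to angles in [y, y + \<delta>], so that differentiation acts on
  \<open>p\<close> alone. The factor exp (\<i> j x) uses the absolute angle, not the one relative to
  \<open>y\<close>. The test \<open>cmod z = 1\<close> makes the function vanish off \<omega> in the
  whole plane.\<close>

definition bump :: "complex poly \<Rightarrow> real \<Rightarrow> int \<Rightarrow> real \<Rightarrow> complex \<Rightarrow> complex" where
  "bump p \<delta> j y z = (if cmod z = 1 \<and> y \<le> Arg2pi z \<and> Arg2pi z \<le> y + \<delta>
     then poly p (of_real (Arg2pi z - y)) * cis (of_int j * Arg2pi z) else 0)"

text \<open>The Fourier coefficient at frequency \<open>l\<close> of \<open>p\<close> cut off to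
  [0, \<delta>], before translation and modulation.\<close>

definition segment_coeff :: "complex poly \<Rightarrow> real \<Rightarrow> int \<Rightarrow> complex" where
  "segment_coeff p \<delta> l = (\<integral>t. indicator {0..\<delta>} t *\<^sub>R (poly p (of_real t) * cis (- of_int l * t)) \<partial>lborel) / (2 * pi)"

lemma borel_measurable_poly_of_real [measurable]:
  "(\<lambda>t. poly p (complex_of_real t)) \<in> borel_measurable borel"
  by (intro borel_measurable_continuous_onI continuous_intros)

lemma borel_measurable_bump [measurable]: "bump p \<delta> j y \<in> borel_measurable borel"
proof -
  note cis_measurable[measurable]
  show ?thesis
    unfolding bump_def[abs_def] by measurable
qed

lemma bump_bounded: "\<exists>B. \<forall>z. cmod (bump p \<delta> j y z) \<le> B"
proof -
  have "compact ((\<lambda>t. poly p (complex_of_real t)) ` {0..\<delta>})"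
    by (intro compact_continuous_image continuous_intros compact_Icc)
  then have "bounded ((\<lambda>t. poly p (complex_of_real t)) ` {0..\<delta>})"
    by (rule compact_imp_bounded)
  then obtain B where B: "\<forall>t\<in>{0..\<delta>}. cmod (poly p (of_real t)) \<le> B"
    by (auto simp: bounded_iff simp del: atLeastAtMost_iff)
  have "cmod (bump p \<delta> j y z) \<le> max B 0" for z
    using bspec[OF B, of "Arg2pi z - y"] by (auto simp: bump_def norm_mult)
  then show ?thesis by blast
qed

lemma bump_square_integrable: "square_integrable circle (bump p \<delta> j y)"
  using bump_bounded[of p \<delta> j y] by (auto intro!: square_integrable_AE_bounded)

lemma segment_integrable:
  "integrable lborel (\<lambda>t. indicator {0..\<delta>} t *\<^sub>R (poly p (complex_of_real t) * cis (- of_int l * t)))"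
  by (rule borel_integrable_atLeastAtMost'[unfolded set_integrable_def]) (intro continuous_intros)

text \<open>Substitute x = y + t. Modulation shifts the frequency by \<open>j\<close>, and
  translation becomes a character of \<open>y\<close>; this dependence on \<open>y\<close> is the
  source of the power series.\<close>

lemma fourier_coeff_bump:
  assumes "0 \<le> y" "y + \<delta> < 2 * pi"
  shows "fourier_coeff (L2_class (bump p \<delta> j y)) n = cis (- of_int (n - j) * y) * segment_coeff p \<delta> (n - j)"
proof -
  note cis_measurable[measurable]
  have "fourier_coeff (L2_class (bump p \<delta> j y)) n =
      (\<integral>x. (indicator {0..<2 * pi} x / (2 * pi)) *\<^sub>R (bump p \<delta> j y (cis x) * cis x powi (- n)) \<partial>lborel)"
    by (simp only: fourier_coeff_L2_class[OF bump_square_integrable])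
      (rule circle_integral, measurable)
  also have "\<dots> = (\<integral>x. indicator {y..y + \<delta>} x *\<^sub>R
      (poly p (of_real (x - y)) * cis (of_int (j - n) * x) / (2 * pi)) \<partial>lborel)"
    using assms by (intro Bochner_Integration.integral_cong)
      (auto simp: indicator_def bump_def Arg2pi_cis cis_powi cis_mult scaleR_conv_of_real algebra_simps)
  also have "\<dots> = (\<integral>t. indicator {y..y + \<delta>} (y + 1 * t) *\<^sub>R
      (poly p (of_real (y + 1 * t - y)) * cis (of_int (j - n) * (y + 1 * t)) / (2 * pi)) \<partial>lborel)"
    by (subst lborel_integral_real_affine[where c = 1 and t = y]) auto
  also have "\<dots> = (\<integral>t. (cis (- of_int (n - j) * y) / (2 * pi)) *
      (indicator {0..\<delta>} t *\<^sub>R (poly p (of_real t) * cis (- of_int (n - j) * t))) \<partial>lborel)"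
    by (intro Bochner_Integration.integral_cong)
      (auto simp: indicator_def cis_mult algebra_simps)
  also have "\<dots> = cis (- of_int (n - j) * y) * segment_coeff p \<delta> (n - j)"
    by (subst integral_mult_right_zero) (simp add: segment_coeff_def)
  finally show ?thesis .
qed

lemma segment_coeff_add: "segment_coeff (p + q) \<delta> l = segment_coeff p \<delta> l + segment_coeff q \<delta> l"
  unfolding segment_coeff_def add_divide_distrib[symmetric]
  by (subst Bochner_Integration.integral_add[symmetric, OF segment_integrable segment_integrable])
    (simp add: algebra_simps)

lemma segment_coeff_smult: "segment_coeff (smult c p) \<delta> l = c * segment_coeff p \<delta> l"
  unfolding segment_coeff_def
  by (simp add: mult_ac flip: integral_mult_right_zero)

text \<open>Integration by parts; the zeros of \<open>p\<close> at 0 and \<delta> remove the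
  boundary terms.\<close>

lemma segment_coeff_pderiv:
  assumes "0 \<le> \<delta>" "poly p 0 = 0" "poly p (of_real \<delta>) = 0"
  shows "segment_coeff (pderiv p) \<delta> l = \<i> * of_int l * segment_coeff p \<delta> l"
proof -
  \<comment> \<open>Chosen so that q(t) exp (- \<i> l t) is the derivative of p(t) exp (- \<i> l
    t).\<close>
  define q where "q = pderiv p + smult (- \<i> * of_int l) p"
  have "(\<integral>t. indicator {0..\<delta>} t *\<^sub>R (poly q (of_real t) * cis (- of_int l * t)) \<partial>lborel) =
    poly p (of_real \<delta>) * cis (- of_int l * \<delta>) - poly p (of_real 0) * cis (- of_int l * 0)"
  proof (rule integral_FTC_atLeastAtMost)
    fix t :: real
    have "((\<lambda>t. poly p (of_real t) * exp (- \<i> * of_int l * of_real t)) has_vector_derivative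
        (poly q (of_real t) * exp (- \<i> * of_int l * of_real t))) (at t within {0..\<delta>})"
      by (rule has_vector_derivative_real_field)
        (auto intro!: derivative_eq_intros simp: q_def algebra_simps)
    then show "((\<lambda>t. poly p (of_real t) * cis (- of_int l * t)) has_vector_derivative
        (poly q (of_real t) * cis (- of_int l * t))) (at t within {0..\<delta>})"
      by (simp add: cis_conv_exp mult.assoc)
  qed (use assms in \<open>auto intro!: continuous_intros\<close>)
  then have "segment_coeff q \<delta> l = 0"
    using assms by (simp add: segment_coeff_def)
  then show ?thesis
    by (simp add: q_def segment_coeff_add segment_coeff_smult del: smult_minus_left)
qed

text \<open>The derivative of p(x - y) exp (\<i> j x) is again a bump, with polynomial p' + \<i> j
  p; on coefficients, \<i> (n - j) + \<i> j = \<i> n.\<close>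

lemma fourier_coeff_bump_deriv:
  assumes "0 \<le> y" "0 \<le> \<delta>" "y + \<delta> < 2 * pi" "poly p 0 = 0" "poly p (of_real \<delta>) = 0"
  shows "fourier_coeff (L2_class (bump (pderiv p + smult (\<i> * of_int j) p) \<delta> j y)) n =
    \<i> * of_int n * fourier_coeff (L2_class (bump p \<delta> j y)) n"
  using assms
  by (simp add: fourier_coeff_bump segment_coeff_add segment_coeff_smult segment_coeff_pderiv algebra_simps)

lemma power_dvd_pderiv:
  fixes r p :: "complex poly"
  assumes "r ^ Suc m dvd p"
  shows "r ^ m dvd pderiv p"
proof -
  obtain q where "p = r ^ Suc m * q"
    using assms by (rule dvdE)
  then show ?thesis
    by (simp add: pderiv_mult pderiv_power_Suc dvd_add dvd_mult dvd_mult2 dvd_smult le_imp_power_dvd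
        del: power_Suc)
qed

text \<open>The polynomial \<open>[:0, of_real \<delta>, -1:]\<close> is t (\<delta> - t). Each of
  its factors pays for one differentiation: it supplies the zeros at both ends, and the next lower
  power still divides the new polynomial. Bessel's inequality ends the induction.\<close>

lemma ell2_fourier_coeff_bump:
  assumes "0 \<le> y" "0 \<le> \<delta>" "y + \<delta> < 2 * pi" "[:0, of_real \<delta>, -1:] ^ m dvd p"
  shows "ell2 (\<lambda>n. of_int n ^ m * fourier_coeff (L2_class (bump p \<delta> j y)) n)"
  using assms(4)
proof (induction m arbitrary: p)
  case 0
  then show ?case by (simp add: ell2_fourier_coeff)
next
  case (Suc m)
  let ?r = "[:0, complex_of_real \<delta>, -1:]"
  let ?p' = "pderiv p + smult (\<i> * of_int j) p"
  have "?r dvd p"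
    using Suc.prems by (metis dvd_mult_left power_Suc)
  then have p0: "poly p 0 = 0" "poly p (of_real \<delta>) = 0"
    by (auto elim!: dvdE)
  have "?r ^ m dvd p"
    using Suc.prems by (metis dvd_mult_right power_Suc)
  then have "?r ^ m dvd ?p'"
    by (intro dvd_add power_dvd_pderiv Suc.prems dvd_smult)
  then have "ell2 (\<lambda>n. of_int n ^ m * fourier_coeff (L2_class (bump ?p' \<delta> j y)) n)"
    by (rule Suc.IH)
  then show ?case
    by (simp add: fourier_coeff_bump_deriv[OF assms(1-3) p0] norm_mult mult_ac)
qed

text \<open>At frequency 0 the integrand is nonnegative on [0, \<delta>] and positive inside. This
  keeps the power series coefficient under study a nonzero multiple of the conjugate of
  \<open>fourier_coeff d j\<close>.\<close>

lemma segment_coeff_0_nonzero: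
  assumes "\<delta> > 0"
  shows "segment_coeff ([:0, of_real \<delta>, -1:] ^ m) \<delta> 0 \<noteq> 0"
proof
  assume 0: "segment_coeff ([:0, of_real \<delta>, -1:] ^ m) \<delta> 0 = 0"
  define g where "g t = indicator {0..\<delta>} t * (t * (\<delta> - t)) ^ m" for t
  have eq: "indicator {0..\<delta>} t *\<^sub>R (poly ([:0, complex_of_real \<delta>, -1:] ^ m) (of_real t) * cis (- of_int 0 * t)) = of_real (g t)" for t
    by (simp add: g_def scaleR_conv_of_real)
  have "integrable lborel (\<lambda>t. complex_of_real (g t))"
    using segment_integrable[of \<delta> "[:0, of_real \<delta>, -1:] ^ m" 0] unfolding eq .
  then have int: "integrable lborel g"
    using integrable_Re by fastforce
  have "complex_of_real (\<integral>t. g t \<partial>lborel) = 0"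
    using 0 unfolding segment_coeff_def eq by simp
  moreover have "g t \<ge> 0" for t
    by (auto simp: g_def indicator_def)
  ultimately have "AE t in lborel. g t = 0"
    using integral_nonneg_eq_0_iff_AE[OF int] by auto
  then have "AE t in lborel. t \<notin> {0<..<\<delta>}"
    by eventually_elim (auto simp: g_def indicator_def)
  then have "emeasure lborel {0<..<\<delta>} = 0"
    by (subst (asm) AE_iff_measurable[of "{0<..<\<delta>}"]) auto
  then show False
    using assms by simp
qed

section \<open>Density\<close>

lemma sobolev_space_iff:
  "f \<in> sobolev_space k \<longleftrightarrow> ell2 (\<lambda>n. of_real (sqrt ((1 + (real_of_int n)\<^sup>2) ^ k)) * fourier_coeff f n)"
  unfolding sobolev_space_def by (simp add: norm_mult power_mult_distrib)

text \<open>The operator (1 + |D|^2)^(k/2), meaningful on \<open>sobolev_space k\<close>. It carries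
  the Sobolev norm to the norm of \<open>circle_L2\<close>, so density becomes a statement about
  closures there.\<close>

definition sobolev_lift :: "nat \<Rightarrow> circle_L2 \<Rightarrow> circle_L2" where
  "sobolev_lift k f = fourier_series (\<lambda>n. of_real (sqrt ((1 + (real_of_int n)\<^sup>2) ^ k)) * fourier_coeff f n)"

lemma sobolev_norm_eq:
  assumes "f \<in> sobolev_space k"
  shows "sobolev_norm k f = norm (sobolev_lift k f)"
proof -
  have "sobolev_inner k f f = (\<Sum>\<^sub>\<infinity>n. complex_of_real ((cmod (of_real (sqrt ((1 + (real_of_int n)\<^sup>2) ^ k)) * fourier_coeff f n))\<^sup>2))"
    unfolding sobolev_inner_def
    by (intro infsum_cong) (simp add: norm_mult power_mult_distrib mult.assoc complex_norm_square del: of_real_power)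
  also have "\<dots> = complex_of_real (\<Sum>\<^sub>\<infinity>n. (cmod (of_real (sqrt ((1 + (real_of_int n)\<^sup>2) ^ k)) * fourier_coeff f n))\<^sup>2)"
    by (intro infsumI has_sum_of_real has_sum_infsum assms[unfolded sobolev_space_iff])
  also have "\<dots> = of_real ((norm (sobolev_lift k f))\<^sup>2)"
    unfolding sobolev_lift_def by (simp only: norm_fourier_series[OF assms[unfolded sobolev_space_iff]])
  finally show ?thesis
    by (simp add: sobolev_norm_def del: of_real_power)
qed

text \<open>The hypothesis speaks of coefficients so that complex \<open>a\<close> and
  \<open>b\<close> are covered.\<close>

lemma sobolev_space_lincomb:
  assumes "f \<in> sobolev_space k" "g \<in> sobolev_space k"
    and "\<And>n. fourier_coeff h n = a * fourier_coeff f n + b * fourier_coeff g n"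
  shows "h \<in> sobolev_space k"
proof -
  let ?w = "\<lambda>n. complex_of_real (sqrt ((1 + (real_of_int n)\<^sup>2) ^ k))"
  have "ell2 (\<lambda>n. a * (?w n * fourier_coeff f n) + b * (?w n * fourier_coeff g n))"
  proof (rule ell2_add)
    show "ell2 (\<lambda>n. a * (?w n * fourier_coeff f n))"
      by (rule ell2_bound[OF assms(1)[unfolded sobolev_space_iff], of _ "cmod a"]) (simp add: norm_mult)
    show "ell2 (\<lambda>n. b * (?w n * fourier_coeff g n))"
      by (rule ell2_bound[OF assms(2)[unfolded sobolev_space_iff], of _ "cmod b"]) (simp add: norm_mult)
  qed
  then show ?thesis
    unfolding sobolev_space_iff assms(3) by (simp add: algebra_simps)
qed

lemma sobolev_lift_add:
  assumes "f \<in> sobolev_space k" "g \<in> sobolev_space k"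
  shows "sobolev_lift k (f + g) = sobolev_lift k f + sobolev_lift k g"
  using assms unfolding sobolev_space_iff sobolev_lift_def fourier_coeff_add distrib_left
  by (rule fourier_series_add)

lemma sobolev_lift_scaleR:
  assumes "f \<in> sobolev_space k"
  shows "sobolev_lift k (r *\<^sub>R f) = r *\<^sub>R sobolev_lift k f"
  using assms unfolding sobolev_space_iff sobolev_lift_def fourier_coeff_scaleR mult_scaleR_right
  by (rule fourier_series_scaleR)

lemma sobolev_space_diff:
  assumes "f \<in> sobolev_space k" "g \<in> sobolev_space k"
  shows "f - g \<in> sobolev_space k" "sobolev_lift k (f - g) = sobolev_lift k f - sobolev_lift k g"
proof -
  show "f - g \<in> sobolev_space k"
    by (rule sobolev_space_lincomb[OF assms, of _ 1 "-1"]) (simp add: fourier_coeff_diff)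
  have g: "(- 1) *\<^sub>R g \<in> sobolev_space k"
    by (rule sobolev_space_lincomb[OF assms(2,2), of _ "-1" 0]) (simp only: fourier_coeff_scaleR, simp)
  show "sobolev_lift k (f - g) = sobolev_lift k f - sobolev_lift k g"
    using sobolev_lift_add[OF assms(1) g] sobolev_lift_scaleR[OF assms(2), of "-1"] by simp
qed

lemma sobolev_space_riesz_projector:
  "f \<in> sobolev_space k \<Longrightarrow> riesz_projector f \<in> sobolev_space k"
  unfolding sobolev_space_iff by (erule ell2_bound[of _ _ 1]) (simp add: fourier_coeff_riesz_projector)

text \<open>In the definition, \<open>w\<close> is the weak derivative of \<open>v\<close> with respect to arc length.\<close>

definition localized :: "complex set \<Rightarrow> nat \<Rightarrow> (complex \<Rightarrow> complex) set" where
  "localized \<omega> k = {v. L2_class v \<in> sobolev_space k \<and> v \<in> borel_measurable borel \<and>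
    (\<forall>z. z \<notin> \<omega> \<longrightarrow> v z = 0) \<and> (\<exists>B. \<forall>z. cmod (v z) \<le> B) \<and>
    (\<exists>w. w \<in> borel_measurable borel \<and> (\<forall>z. z \<notin> \<omega> \<longrightarrow> w z = 0) \<and> (\<exists>B. \<forall>z. cmod (w z) \<le> B) \<and>
      (\<forall>n. fourier_coeff (L2_class w) n = \<i> * of_int n * fourier_coeff (L2_class v) n))}"

lemma localized_square_integrable: "v \<in> localized \<omega> k \<Longrightarrow> square_integrable circle v"
  unfolding localized_def by (auto intro!: square_integrable_AE_bounded)

lemma bounded_lincomb:
  fixes v w :: "complex \<Rightarrow> complex"
  assumes "\<exists>B. \<forall>z. cmod (v z) \<le> B" "\<exists>B. \<forall>z. cmod (w z) \<le> B"
  shows "\<exists>B. \<forall>z. cmod (a * v z + b * w z) \<le> B"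
proof -
  obtain B C where B: "\<And>z. cmod (v z) \<le> B" "\<And>z. cmod (w z) \<le> C"
    using assms by blast
  have "cmod (a * v z + b * w z) \<le> cmod a * B + cmod b * C" for z
    by (rule norm_triangle_le) (auto simp: norm_mult intro!: add_mono mult_left_mono B)
  then show ?thesis by blast
qed

text \<open>Complex coefficients matter: stability under multiplication by \<i> upgrades
  orthogonality for the real scalar product to vanishing of the complex sum.\<close>

lemma localized_lincomb:
  assumes "v \<in> localized \<omega> k" "v' \<in> localized \<omega> k"
  shows "(\<lambda>z. a * v z + b * v' z) \<in> localized \<omega> k"
proof -
  note sq = localized_square_integrable[OF assms(1)] localized_square_integrable[OF assms(2)]
  obtain w where w: "w \<in> borel_measurable borel" "\<forall>z. z \<notin> \<omega> \<longrightarrow> w z = 0" "\<exists>B. \<forall>z. cmod (w z) \<le> B"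
      "\<forall>n. fourier_coeff (L2_class w) n = \<i> * of_int n * fourier_coeff (L2_class v) n"
    using assms(1) unfolding localized_def by blast
  obtain w' where w': "w' \<in> borel_measurable borel" "\<forall>z. z \<notin> \<omega> \<longrightarrow> w' z = 0" "\<exists>B. \<forall>z. cmod (w' z) \<le> B"
      "\<forall>n. fourier_coeff (L2_class w') n = \<i> * of_int n * fourier_coeff (L2_class v') n"
    using assms(2) unfolding localized_def by blast
  have sq': "square_integrable circle w" "square_integrable circle w'"
    using w w' by (auto intro!: square_integrable_AE_bounded)
  have "L2_class (\<lambda>z. a * v z + b * v' z) \<in> sobolev_space k"
    by (rule sobolev_space_lincomb[OF _ _ fourier_coeff_lincomb[OF sq]])
      (use assms in \<open>auto simp: localized_def\<close>)
  moreover have "\<exists>B. \<forall>z. cmod (a * v z + b * v' z) \<le> B"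
    by (rule bounded_lincomb) (use assms in \<open>auto simp: localized_def\<close>)
  moreover have "(\<lambda>z. a * v z + b * v' z) \<in> borel_measurable borel"
    using assms by (auto simp: localized_def)
  moreover have "\<forall>z. z \<notin> \<omega> \<longrightarrow> a * v z + b * v' z = 0"
    using assms by (auto simp: localized_def)
  moreover have "(\<lambda>z. a * w z + b * w' z) \<in> borel_measurable borel"
    using w(1) w'(1) by simp
  moreover have "\<forall>z. z \<notin> \<omega> \<longrightarrow> a * w z + b * w' z = 0"
    using w(2) w'(2) by simp
  moreover have "\<exists>B. \<forall>z. cmod (a * w z + b * w' z) \<le> B"
    using w(3) w'(3) by (rule bounded_lincomb)
  moreover have "\<forall>n. fourier_coeff (L2_class (\<lambda>z. a * w z + b * w' z)) n =
      \<i> * of_int n * fourier_coeff (L2_class (\<lambda>z. a * v z + b * v' z)) n"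
    using w(4) w'(4) by (simp add: fourier_coeff_lincomb[OF sq] fourier_coeff_lincomb[OF sq'] algebra_simps)
  ultimately show ?thesis
    unfolding localized_def mem_Collect_eq by blast
qed

lemma localized_null_controllable:
  assumes "\<omega> \<in> sets borel" "T > 0" "v \<in> localized \<omega> k"
  shows "riesz_projector (L2_class v) \<in> null_controllable \<omega> T \<inter> sobolev_space k"
proof
  obtain w B C where w: "w \<in> borel_measurable borel" "\<And>z. z \<notin> \<omega> \<Longrightarrow> w z = 0"
    "\<And>z. cmod (v z) \<le> B" "\<And>z. cmod (w z) \<le> C"
    "\<And>n. fourier_coeff (L2_class w) n = \<i> * of_int n * fourier_coeff (L2_class v) n"
    using assms(3) unfolding localized_def by blast
  show "riesz_projector (L2_class v) \<in> null_controllable \<omega> T"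
    by (rule riesz_projector_null_controllable[where w = w and B = "max B C"])
      (use assms w in \<open>auto simp: localized_def le_max_iff_disj\<close>)
  show "riesz_projector (L2_class v) \<in> sobolev_space k"
    using assms(3) by (intro sobolev_space_riesz_projector) (simp add: localized_def)
qed

text \<open>With x = n^2 this controls the Sobolev weight by 1 and n^(2k), the weights supplied by
  Bessel's inequality for the bump and by \<open>ell2_fourier_coeff_bump\<close>.\<close>

lemma power_one_plus_le:
  fixes x :: real
  assumes "0 \<le> x"
  shows "(1 + x) ^ k \<le> 2 ^ k * (1 + x ^ k)"
proof (cases "x \<le> 1")
  case True
  then have "(1 + x) ^ k \<le> 2 ^ k" using assms by (intro power_mono) auto
  also have "\<dots> \<le> 2 ^ k * (1 + x ^ k)" using assms by simp
  finally show ?thesis .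
next
  case False
  then have "(1 + x) ^ k \<le> (2 * x) ^ k" by (intro power_mono) auto
  also have "\<dots> \<le> 2 ^ k * (1 + x ^ k)" by (simp add: power_mult_distrib)
  finally show ?thesis .
qed

text \<open>Of the \<open>Suc k\<close> factors, \<open>k\<close> give the Sobolev regularity; the
  extra one makes the bump vanish at both ends even for k = 0, so that its derivative is a bounded
  bump with the same support.\<close>

lemma bump_localized:
  assumes "0 \<le> y" "0 < \<delta>" "y + \<delta> < 2 * pi" "cis ` {y..y + \<delta>} \<subseteq> \<omega>"
  shows "bump ([:0, of_real \<delta>, -1:] ^ Suc k) \<delta> j y \<in> localized \<omega> k"
proof -
  define p where "p = [:0, complex_of_real \<delta>, -1:] ^ Suc k"
  have supp: "bump q \<delta> j y z = 0" if "z \<notin> \<omega>" for q z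
  proof (rule ccontr)
    assume "bump q \<delta> j y z \<noteq> 0"
    then have "cmod z = 1" "Arg2pi z \<in> {y..y + \<delta>}"
      by (auto simp: bump_def split: if_splits)
    then have "z \<in> cis ` {y..y + \<delta>}"
      by (intro image_eqI[of _ _ "Arg2pi z"]) (simp_all add: cis_Arg2pi)
    then show False using assms(4) that by blast
  qed
  let ?c = "fourier_coeff (L2_class (bump p \<delta> j y))"
  have dvd: "[:0, complex_of_real \<delta>, -1:] ^ k dvd p"
    unfolding p_def by (intro le_imp_power_dvd) simp
  have "(\<lambda>n. (1 + (real_of_int n)\<^sup>2) ^ k * (cmod (?c n))\<^sup>2) summable_on UNIV"
  proof (rule summable_on_comparison_test)
    show "(\<lambda>n. 2 ^ k * ((cmod (?c n))\<^sup>2 + (cmod (of_int n ^ k * ?c n))\<^sup>2)) summable_on UNIV"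
      using assms dvd
      by (intro summable_on_cmult_right summable_on_add ell2_fourier_coeff ell2_fourier_coeff_bump) auto
    fix n
    have "(cmod (of_int n ^ k * ?c n))\<^sup>2 = ((real_of_int n)\<^sup>2) ^ k * (cmod (?c n))\<^sup>2"
      by (simp add: norm_mult norm_power power_mult_distrib mult.commute[of 2 k] power_even_abs
          flip: power_mult)
    then show "(1 + (real_of_int n)\<^sup>2) ^ k * (cmod (?c n))\<^sup>2 \<le> 2 ^ k * ((cmod (?c n))\<^sup>2 + (cmod (of_int n ^ k * ?c n))\<^sup>2)"
      using mult_right_mono[OF power_one_plus_le[of "(real_of_int n)\<^sup>2" k], of "(cmod (?c n))\<^sup>2"]
      by (simp only: distrib_right distrib_left mult_1 mult_1_right mult.assoc) simp
  qed auto
  then have "L2_class (bump p \<delta> j y) \<in> sobolev_space k"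
    by (simp add: sobolev_space_def)
  moreover have "poly p 0 = 0" "poly p (of_real \<delta>) = 0"
    by (simp_all add: p_def)
  then have "\<forall>n. fourier_coeff (L2_class (bump (pderiv p + smult (\<i> * of_int j) p) \<delta> j y)) n = \<i> * of_int n * ?c n"
    using assms by (intro allI fourier_coeff_bump_deriv) auto
  ultimately have "bump p \<delta> j y \<in> localized \<omega> k"
    unfolding localized_def mem_Collect_eq using supp bump_bounded borel_measurable_bump by blast
  then show ?thesis
    unfolding p_def .
qed

section \<open>Orthogonality to the localized states\<close>

lemma summable_on_int_imp_summable_nat:
  fixes g :: "int \<Rightarrow> real"
  assumes "g summable_on UNIV"
  shows "summable (\<lambda>n. g (int n))"
proof -
  have "g summable_on range int"
    using assms by (rule summable_on_subset) auto
  then have "(g \<circ> int) summable_on UNIV"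
    by (subst (asm) summable_on_reindex) auto
  then show ?thesis
    using summable_on_imp_summable[of "g \<circ> int"] by (simp add: o_def)
qed

lemma has_sum_int_imp_sums_nat:
  assumes "((\<lambda>n. if n \<ge> 0 then g n else 0) has_sum S) (UNIV :: int set)"
  shows "(\<lambda>n. g (int n)) sums S"
proof -
  have "(g has_sum S) (range int) \<longleftrightarrow> ((\<lambda>n. if n \<ge> 0 then g n else 0) has_sum S) UNIV"
    by (rule has_sum_cong_neutral) (auto simp: image_iff intro: nonneg_int_cases)
  then have "(g has_sum S) (range int)"
    using assms by blast
  then have "((g \<circ> int) has_sum S) UNIV"
    by (subst (asm) has_sum_reindex) auto
  then show ?thesis
    using has_sum_imp_sums[of "g \<circ> int"] by (simp add: o_def)
qed

text \<open>Here \<open>d\<close> is a vector of \<open>circle_L2\<close> tested against lifts, so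
  the square root of the Sobolev weight enters once, as \<open>W\<close>. Each \<open>j\<close> has
  its own family of bumps.\<close>

lemma orthogonal_localized_imp_zero:
  assumes arc: "0 \<le> \<alpha>" "\<alpha> < \<beta>" "\<beta> < 2 * pi" "cis ` {\<alpha>..\<beta>} \<subseteq> \<omega>"
    and orth: "\<And>v. v \<in> localized \<omega> k \<Longrightarrow> inner d (sobolev_lift k (riesz_projector (L2_class v))) = 0"
    and j: "j \<ge> 0"
  shows "fourier_coeff d j = 0"
proof -
  \<comment> \<open>Half the arc is the length of the bump; the other half is the range through
    which it slides.\<close>
  define \<delta> where "\<delta> = (\<beta> - \<alpha>) / 2"
  have \<delta>: "\<delta> > 0"
    using arc by (simp add: \<delta>_def)
  define p where "p = [:0, complex_of_real \<delta>, -1:] ^ Suc k"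
  define W where "W n = complex_of_real (sqrt ((1 + (real_of_int n)\<^sup>2) ^ k))" for n :: int
  define v where "v y = bump p \<delta> j y" for y
  define s where "s y n = W n * fourier_coeff (L2_class (v y)) n" for y n
  \<comment> \<open>Independent of \<open>y\<close>: translation leaves the phase exp (\<i> j y),
    common to all terms and divided out, and the power of \<open>cis (- y)\<close>. At n = j the
    last factor is \<open>segment_coeff p \<delta> 0\<close>.\<close>
  define b where "b n = cnj (fourier_coeff d (int n)) * W (int n) * segment_coeff p \<delta> (int n - j)" for n
  have y: "0 \<le> y" "y + \<delta> < 2 * pi" "v y \<in> localized \<omega> k" if "\<alpha> \<le> y" "y < \<alpha> + \<delta>" for y
  proof -
    show *: "0 \<le> y" "y + \<delta> < 2 * pi"
      using that arc by (auto simp: \<delta>_def field_simps)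
    have "{y..y + \<delta>} \<subseteq> {\<alpha>..\<beta>}"
      using that by (auto simp: \<delta>_def field_simps)
    then have "cis ` {y..y + \<delta>} \<subseteq> \<omega>"
      using arc(4) by blast
    then show "v y \<in> localized \<omega> k"
      unfolding v_def p_def using * \<delta> by (intro bump_localized) auto
  qed
  have s_eq: "cnj (fourier_coeff d (int n)) * s y (int n) = cis (of_int j * y) * (b n * cis (- y) ^ n)"
    if "\<alpha> \<le> y" "y < \<alpha> + \<delta>" for y n
  proof -
    have "s y (int n) = W (int n) * (cis (- of_int (int n - j) * y) * segment_coeff p \<delta> (int n - j))"
      unfolding s_def v_def using y[OF that] by (simp add: fourier_coeff_bump)
    also have "cis (- of_int (int n - j) * y) = cis (of_int j * y) * cis (- y) ^ n"
      by (simp add: Complex.DeMoivre cis_mult algebra_simps)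
    finally show ?thesis
      by (simp add: b_def mult_ac)
  qed
  have s_ell2: "ell2 (s y)" if "\<alpha> \<le> y" "y < \<alpha> + \<delta>" for y
    using y(3)[OF that] unfolding localized_def sobolev_space_iff s_def W_def by blast
  have real_sum: "(\<lambda>n. Re (cnj (fourier_coeff d (int n)) * (a * s y (int n)))) sums 0"
    if y_arc: "\<alpha> \<le> y" "y < \<alpha> + \<delta>" for y a
  proof (rule has_sum_int_imp_sums_nat)
    \<comment> \<open>The summand with coefficient 0 brings a single multiple into the form of the
      rules for linear combinations.\<close>
    have loc: "(\<lambda>z. a * v y z + 0 * v y z) \<in> localized \<omega> k"
      using y(3)[OF y_arc] by (intro localized_lincomb)
    note sq = localized_square_integrable[OF y(3)[OF y_arc]]
    let ?c = "\<lambda>n. if n \<ge> 0 then a * s y n else 0"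
    have "W n * fourier_coeff (riesz_projector (L2_class (\<lambda>z. a * v y z + 0 * v y z))) n = ?c n" for n
      unfolding fourier_coeff_riesz_projector fourier_coeff_lincomb[OF sq sq] s_def by simp
    then have "sobolev_lift k (riesz_projector (L2_class (\<lambda>z. a * v y z + 0 * v y z))) = fourier_series ?c"
      unfolding sobolev_lift_def W_def by presburger
    moreover have "ell2 ?c"
      by (rule ell2_bound[OF s_ell2[OF y_arc], of _ "cmod a"]) (simp add: norm_mult)
    ultimately have "((\<lambda>n. Re (fourier_coeff d n * cnj (?c n))) has_sum 0) UNIV"
      using inner_fourier_series[of ?c d] orth[OF loc] by simp
    also have "(\<lambda>n. Re (fourier_coeff d n * cnj (?c n))) =
        (\<lambda>n. if n \<ge> 0 then Re (cnj (fourier_coeff d n) * (a * s y n)) else 0)"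
      by (auto simp: fun_eq_iff algebra_simps)
    finally show "((\<lambda>n. if n \<ge> 0 then Re (cnj (fourier_coeff d n) * (a * s y n)) else 0) has_sum 0) UNIV" .
  qed
  \<comment> \<open>a = 1 gives the real part and a = - \<i> the imaginary part.\<close>
  have sums: "(\<lambda>n. cnj (fourier_coeff d (int n)) * s y (int n)) sums 0" if "\<alpha> \<le> y" "y < \<alpha> + \<delta>" for y
    using real_sum[OF that, of 1] real_sum[OF that, of "- \<i>"]
    by (simp add: sums_complex_iff algebra_simps)
  have zero: "(\<Sum>n. b n * cis y ^ n) = 0" if "- (\<alpha> + \<delta>) < y" "y < - \<alpha>" for y
  proof -
    have *: "\<alpha> \<le> - y" "- y < \<alpha> + \<delta>"
      using that by auto
    have "(\<lambda>n. cis (of_int j * - y) * (b n * cis y ^ n)) sums 0"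
      using sums[OF *] s_eq[OF *] by simp
    then have "(\<lambda>n. b n * cis y ^ n) sums 0"
      by (subst (asm) sums_mult_iff[where d = 0, simplified]) auto
    then show ?thesis by (rule sums_unique[symmetric])
  qed
  \<comment> \<open>The modulus of each term is the same for every position \<open>y\<close>, so y =
    \<alpha> serves; there \<open>b n\<close> has the modulus of a product of two square summable
    sequences.\<close>
  have "summable (\<lambda>n. cmod (b n))"
  proof (rule summable_comparison_test')
    have a: "\<alpha> \<le> \<alpha>" "\<alpha> < \<alpha> + \<delta>"
      using \<delta> by auto
    show "summable (\<lambda>n. (cmod (fourier_coeff d (int n)))\<^sup>2 + (cmod (s \<alpha> (int n)))\<^sup>2)"
      by (rule summable_on_int_imp_summable_nat)
        (intro summable_on_add ell2_fourier_coeff s_ell2[OF a])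
    fix n :: nat
    have "cmod (b n) = cmod (cnj (fourier_coeff d (int n)) * s \<alpha> (int n))"
      unfolding s_eq[OF a] by (simp add: norm_mult norm_power)
    also have "\<dots> = cmod (fourier_coeff d (int n)) * cmod (s \<alpha> (int n))"
      by (simp add: norm_mult)
    finally show "norm (cmod (b n)) \<le> (cmod (fourier_coeff d (int n)))\<^sup>2 + (cmod (s \<alpha> (int n)))\<^sup>2"
      using sum_squares_bound[of "cmod (fourier_coeff d (int n))" "cmod (s \<alpha> (int n))"]
        mult_nonneg_nonneg[OF norm_ge_zero norm_ge_zero, of "fourier_coeff d (int n)" "s \<alpha> (int n)"]
      unfolding real_norm_def abs_norm_cancel by linarith
  qed
  then have "b (nat j) = 0"
    by (rule power_series_zero_on_arc[of b "- (\<alpha> + \<delta>)" "- \<alpha>"]) (use zero \<delta> in auto)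
  moreover have "segment_coeff p \<delta> 0 \<noteq> 0"
    unfolding p_def by (rule segment_coeff_0_nonzero[OF \<delta>])
  moreover have "W j \<noteq> 0"
    by (simp add: W_def add_nonneg_eq_0_iff)
  ultimately show ?thesis
    using j by (simp add: b_def)
qed

text \<open>The coefficients of \<open>d\<close> at negative frequencies are not controlled, so d =
  0 is not read off from them. Instead \<open>d\<close> is orthogonal to the lift of
  \<open>f\<close>, whose coefficients vanish exactly there, and to \<open>p\<close> by continuity;
  hence it is orthogonal to \<open>d\<close>, their difference.\<close>

lemma localized_dense:
  assumes "open_strict_interval \<omega>" "f \<in> hardy_space \<inter> sobolev_space k"
  shows "sobolev_lift k f \<in> closure ((\<lambda>v. sobolev_lift k (riesz_projector (L2_class v))) ` localized \<omega> k)"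
    (is "_ \<in> closure ?S")
proof -
  obtain \<alpha> \<beta> where arc: "0 \<le> \<alpha>" "\<alpha> < \<beta>" "\<beta> < 2 * pi" "cis ` {\<alpha>..\<beta>} \<subseteq> \<omega>"
    using open_strict_interval_contains_arc[OF assms(1)] by metis
  let ?L = "\<lambda>v. sobolev_lift k (riesz_projector (L2_class v))"
  have loc: "L2_class v \<in> sobolev_space k" if "v \<in> localized \<omega> k" for v
    using that by (simp add: localized_def)
  have lincomb: "a *\<^sub>R ?L v + b *\<^sub>R ?L v' = ?L (\<lambda>z. of_real a * v z + of_real b * v' z)"
    if "v \<in> localized \<omega> k" "v' \<in> localized \<omega> k" for v v' a b
  proof -
    note sq = that[THEN localized_square_integrable]
    have sob: "r *\<^sub>R riesz_projector (L2_class u) \<in> sobolev_space k" if "u \<in> localized \<omega> k" for r u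
    proof -
      note u = sobolev_space_riesz_projector[OF loc[OF that]]
      show ?thesis
        by (rule sobolev_space_lincomb[OF u u, of _ "of_real r" 0])
          (simp add: fourier_coeff_scaleR scaleR_conv_of_real)
    qed
    have "a *\<^sub>R ?L v + b *\<^sub>R ?L v' =
        sobolev_lift k (a *\<^sub>R riesz_projector (L2_class v) + b *\<^sub>R riesz_projector (L2_class v'))"
      using that by (simp add: sobolev_lift_add sob sobolev_lift_scaleR sobolev_space_riesz_projector loc)
    also have "\<dots> = ?L (\<lambda>z. of_real a * v z + of_real b * v' z)"
      unfolding sobolev_lift_def
      by (intro arg_cong[of _ _ fourier_series] ext)
        (simp add: fourier_coeff_add fourier_coeff_scaleR fourier_coeff_riesz_projector
          fourier_coeff_lincomb[OF sq] scaleR_conv_of_real)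
    finally show ?thesis .
  qed
  have ne: "\<exists>v. v \<in> localized \<omega> k"
  proof -
    have "bump ([:0, of_real (\<beta> - \<alpha>), -1:] ^ Suc k) (\<beta> - \<alpha>) 0 \<alpha> \<in> localized \<omega> k"
      using arc by (intro bump_localized) auto
    then show ?thesis by blast
  qed
  have closed_lincomb: "a *\<^sub>R x + b *\<^sub>R x' \<in> ?S" if "x \<in> ?S" "x' \<in> ?S" for a b x x'
    using that lincomb localized_lincomb by (auto intro!: image_eqI)
  have "subspace ?S"
  proof (rule subspaceI)
    obtain v where "v \<in> localized \<omega> k" using ne by blast
    then show "0 \<in> ?S"
      using closed_lincomb[of "?L v" "?L v" 0 0] by (simp add: image_eqI)
  qed (use closed_lincomb[of _ _ 1 1] closed_lincomb[of _ _ _ 0] in auto)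
  then obtain p d where pd: "sobolev_lift k f = p + d" "p \<in> closure ?S" "\<And>s. s \<in> ?S \<Longrightarrow> inner d s = 0"
    using orthogonal_decomposition by metis
  have d0: "fourier_coeff d n = 0" if "n \<ge> 0" for n
    by (rule orthogonal_localized_imp_zero[OF arc _ that]) (use pd(3) in auto)
  have f0: "fourier_coeff f n = 0" if "n < 0" for n
    using assms(2) that by (auto simp: hardy_space_def fourier_coeff_riesz_projector)
  have "((\<lambda>n. Re (fourier_coeff d n * cnj (of_real (sqrt ((1 + (real_of_int n)\<^sup>2) ^ k)) * fourier_coeff f n)))
      has_sum inner d (sobolev_lift k f)) UNIV"
    unfolding sobolev_lift_def
    by (rule inner_fourier_series) (use assms(2) in \<open>simp add: sobolev_space_iff\<close>)
  moreover have "fourier_coeff d n * cnj (of_real (sqrt ((1 + (real_of_int n)\<^sup>2) ^ k)) * fourier_coeff f n) = 0" for n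
    using d0[of n] f0[of n] by (cases "n \<ge> 0") auto
  ultimately have "((\<lambda>_ :: int. 0 :: real) has_sum inner d (sobolev_lift k f)) UNIV"
    by (simp only: zero_complex.sel)
  then have "inner d (sobolev_lift k f) = 0"
    using infsumI by fastforce
  moreover have "inner d p = 0"
  proof -
    obtain s where s: "\<And>n. s n \<in> ?S" "s \<longlonglongrightarrow> p"
      using pd(2) unfolding closure_sequential by blast
    have "(\<lambda>n. inner d (s n)) \<longlonglongrightarrow> inner d p"
      by (intro tendsto_intros s)
    then show ?thesis
      using pd(3)[OF s(1)] by (simp add: LIMSEQ_const_iff)
  qed
  ultimately have "d = 0"
    by (simp add: pd(1) inner_add_right)
  then show ?thesis
    using pd by simp
qed

theorem corollary1p8:
  fixes \<omega> :: "complex set" and T :: real and k :: nat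
  assumes "open_strict_interval \<omega>" and "T > 0"
  shows "\<forall>f \<in> hardy_space \<inter> sobolev_space k. \<forall>\<epsilon>>0.
    \<exists>g \<in> null_controllable \<omega> T \<inter> sobolev_space k. sobolev_norm k (f - g) < \<epsilon>"
proof (intro ballI allI impI)
  fix f \<epsilon> assume f: "f \<in> hardy_space \<inter> sobolev_space k" and \<epsilon>: "(0::real) < \<epsilon>"
  obtain v where v: "v \<in> localized \<omega> k"
    "dist (sobolev_lift k (riesz_projector (L2_class v))) (sobolev_lift k f) < \<epsilon>"
    using localized_dense[OF assms(1) f] \<epsilon> unfolding closure_approachable by blast
  define g where "g = riesz_projector (L2_class v)"
  have g: "g \<in> null_controllable \<omega> T \<inter> sobolev_space k"
    unfolding g_def using open_strict_interval_borel[OF assms(1)] assms(2) v(1)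
    by (rule localized_null_controllable)
  have "sobolev_norm k (f - g) < \<epsilon>"
    using f g v(2) by (simp add: sobolev_norm_eq sobolev_space_diff dist_norm norm_minus_commute flip: g_def)
  then show "\<exists>g \<in> null_controllable \<omega> T \<inter> sobolev_space k. sobolev_norm k (f - g) < \<epsilon>"
    using g by blast
qed

end
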